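(* Let $k\geq 3$, $r\ge1$, $s_1\geq\cdots\geq s_{r+1}\geq 1$ and $\beta\ge0$ be fixed integers and let $n$ be sufficiently large (depending on $s_1,\ldots,s_{r+1},k,\beta$). Put $m=\lfloor (s_{r+1}+\beta)k/(\beta+1)\rfloor$ and $\hat\beta=\hat\beta(k,s_{r+1},\beta)$. Let $\mathcal{F}\subseteq\binom{[n]}{k}$ be such that the induced subgraph $KG_{n,k}[\mathcal{F}]$ contains no subgraph isomorphic to the complete multipartite graph $K_{s_1,\ldots,s_{r+1}}$, and $\ell_{r+1}(\mathcal{F})\geq s_{r+1}+\beta$. Then $$|\mathcal{F}|\leq\binom{n}{k}-\binom{n-r}{k}-\binom{n-m-r}{k-1}+s_r+s_{r+1}+\hat\beta-1.$$ Equality holds if and only if there exist pairwise distinct $k$-sets $A_1,\ldots,A_{s_{r+1}+\hat\beta}$ and $k$-sets $F_1,\ldots,F_{s_r-1}$ such that (1) $[r]\cap\bigcup_{i}A_i=\varnothing$; (2) $|T(A_1,\ldots,A_{s_{r+1}+\hat\beta}:s_{r+1})|=m$; (3) for each $i\le s_r-1$, $F_i\in\mathcal{S}_r\setminus\mathcal{S}_r^{[r-1]}(A_1,\ldots,A_{s_{r+1}+\hat\beta}:s_{r+1})$ and $F_i\cap[r-1]=\varnothing$; (4) the family $\{A_1,\ldots,A_{s_{r+1}+\hat\beta},F_1,\ldots,F_{s_r-1}\}$ is $(s_{r+1},s_r)$-union intersecting; and $\mathcal{F}$ is isomorphic to $\bigcup_{i=1}^{r-1}\mathcal{S}_i\c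up\mathcal{S}_r^{[r-1]}(A_1,\ldots,A_{s_{r+1}+\hat\beta}:s_{r+1})\cup\{A_1,\ldots,A_{s_{r+1}+\hat\beta}\}\cup\{F_1,\ldots,F_{s_r-1}\}$.
   Context: $KG_{n,k}$ is the Kneser graph with vertex set $\binom{[n]}{k}$, two $k$-sets adjacent iff disjoint; $KG_{n,k}[\mathcal{F}]$ is the induced subgraph on $\mathcal{F}$. For $p\ge2$, $\ell_p(\mathcal{F})$ is the minimum number of members of $\mathcal{F}$ whose removal leaves a family with no $p$ pairwise disjoint members. $\mathcal{S}_i=\{A\in\binom{[n]}{k}:i\in A\}$. For $k$-sets $A_1,\ldots,A_p$ ($p\ge s$) disjoint from $[r]$: $\mathcal{S}_r^{[r-1]}(A_1,\ldots,A_p:s)$ is the family of all $A\in\mathcal{S}_r$ with $A\cap[r-1]=\varnothing$ that are disjoint from at most $s-1$ of the $A_i$; $T(A_1,\ldots,A_p:s)$ is the set of elements lying in at least $p-s+1$ of the $A_i$. A family $\mathcal{G}$ of $k$-sets is $(s,t)$-union intersecting if for any pairwise distinct $B_1,\ldots,B_{s+t}\in\mathcal{G}$, $(\bigcup_{i=1}^sB_i)\cap(\bigcup_{i=1}^tB_{s+i})\ne\varnothing$. For nonnegative integers $k,s,\beta$ with $s\ge1$: if $\lfloor (s+\beta)k/(\beta+1)\rfloor>k$, $\hat\beta(k,s,\beta)$ is the largest positive integer $b$ with $\lfloor (s+b)k/(b+1)\rfloor=\lfloor (s+\beta)k/(\beta+1)\rfloor$; if it equals $k$, $\hat\beta(k,s,\beta)=\beta$.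 Two families are isomorphic if some permutation of $[n]$ maps one onto the other.
   Formalization: The k-sets F_1,…,F_{s_r-1} are required to be pairwise distinct (otherwise the "if" direction fails), and β̂ is the largest nonnegative (not positive) integer b, so that β̂=0 when β=0 and s_{r+1}≥2, where no positive b exists. *)

theory Defs
  imports
    "HOL-Library.Ramsey"
    "HOL-Combinatorics.Permutations"
    "Graph_Theory.Graph_Theory"
begin

text \<open>
  The ground set \<open>[n]\<close> is \<open>{1..n}\<close>, and \<open>nsets {1..n} k\<close> is the family of its \<open>k\<close>-subsets.
  Undirected graphs are represented as symmetric digraphs.
\<close>

definition kneser_graph :: "nat \<Rightarrow> nat \<Rightarrow> nat set pair_pre_digraph" where
  "kneser_graph n k =
     \<lparr>pverts = nsets {1..n} k,
      parcs = {(A, B) \<in> nsets {1..n} k \<times> nsets {1..n} k. A \<inter> B = {}}\<rparr>"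

text \<open>The complete multipartite graph with parts \<open>{i} \<times> {1..s i}\<close> for \<open>i = 1, \<dots>, q\<close>.\<close>

definition complete_multipartite :: "nat \<Rightarrow> (nat \<Rightarrow> nat) \<Rightarrow> (nat \<times> nat) pair_pre_digraph" where
  "complete_multipartite q s =
     (let V = (SIGMA i:{1..q}. {1..s i})
      in \<lparr>pverts = V, parcs = {(x, y) \<in> V \<times> V. fst x \<noteq> fst y}\<rparr>)"

definition contains_subgraph :: "('a, 'b) pre_digraph \<Rightarrow> ('c, 'd) pre_digraph \<Rightarrow> bool" where
  "contains_subgraph G K \<longleftrightarrow> (\<exists>H. subgraph H G \<and> digraph_iso H K)"

text \<open>The parameter \<open>\<ell>\<^sub>p\<close> of a finite family.\<close>

definition ell :: "nat \<Rightarrow> 'a set set \<Rightarrow> nat" where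
  "ell p \<F> =
     (LEAST l. \<exists>\<R>\<subseteq>\<F>. finite \<R> \<and> card \<R> = l \<and>
        \<not> (\<exists>\<P>\<subseteq>\<F> - \<R>. card \<P> = p \<and> pairwise disjnt \<P>))"

definition star :: "nat \<Rightarrow> nat \<Rightarrow> nat \<Rightarrow> nat set set" where
  "star n k i = {A \<in> nsets {1..n} k. i \<in> A}"

text \<open>
  In the next two definitions the sets \<open>A\<^sub>1, \<dots>, A\<^sub>p\<close> are the values of a function \<open>A\<close> on
  \<open>{1..p}\<close>; they are meant for \<open>1 \<le> s \<le> p\<close>, where the subtractions do not truncate.
\<close>

definition star_part ::
  "nat \<Rightarrow> nat \<Rightarrow> nat \<Rightarrow> nat \<Rightarrow> (nat \<Rightarrow> nat set) \<Rightarrow> nat \<Rightarrow> nat set set" where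
  "star_part n k r p A s =
     {B \<in> star n k r. B \<inter> {1..r - 1} = {} \<and> card {i \<in> {1..p}. B \<inter> A i = {}} \<le> s - 1}"

definition T_set :: "nat \<Rightarrow> (nat \<Rightarrow> 'a set) \<Rightarrow> nat \<Rightarrow> 'a set" where
  "T_set p A s = {x. p - s + 1 \<le> card {i \<in> {1..p}. x \<in> A i}}"

definition union_intersecting :: "nat \<Rightarrow> nat \<Rightarrow> 'a set set \<Rightarrow> bool" where
  "union_intersecting s t \<G> \<longleftrightarrow>
     (\<forall>B. inj_on B {1..s + t} \<and> B ` {1..s + t} \<subseteq> \<G> \<longrightarrow>
        (\<Union>i\<in>{1..s}. B i) \<inter> (\<Union>i\<in>{1..t}. B (s + i)) \<noteq> {})"

text \<open>
  The maximum ranges over all natural numbers \<open>b\<close>. If \<open>\<beta> > 0\<close>, then \<open>\<beta>\<close> itself is a candidate, so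
  allowing \<open>b = 0\<close> changes nothing; if \<open>\<beta> = 0\<close> and \<open>s > 1\<close>, then \<open>b = 0\<close> is the only candidate.
  The candidates are bounded, because \<open>(s + b) * k div (b + 1) = k\<close> for large \<open>b\<close>.
\<close>

definition beta_hat :: "nat \<Rightarrow> nat \<Rightarrow> nat \<Rightarrow> nat" where
  "beta_hat k s \<beta> =
     (if (s + \<beta>) * k div (\<beta> + 1) > k
      then GREATEST b. (s + b) * k div (b + 1) = (s + \<beta>) * k div (\<beta> + 1)
      else \<beta>)"

definition isomorphic_families :: "nat \<Rightarrow> nat set set \<Rightarrow> nat set set \<Rightarrow> bool" where
  "isomorphic_families n \<F> \<G> \<longleftrightarrow> (\<exists>\<pi>. \<pi> permutes {1..n} \<and> \<G> = (\<lambda>A. \<pi> ` A) ` \<F>)"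

end

theory Submission
  imports Defs
begin

text \<open>
  Call a set full if it extends to members of \<open>\<F>\<close> that avoid any prescribed bounded set. Disjoint full
  sets can be extended greedily to a complete multipartite configuration, and a set that is not full
  has small degree, because all members containing it meet a bounded set. Counting members by the
  small full sets that they contain shows that a large \<open>\<F>\<close> has \<open>r - 1\<close> full singletons. The
  members that avoid these singletons form a \<open>K\<^bsub>s,t\<^esub>\<close>-free family with \<open>s = s\<^bsub>r+1\<^esub>\<close> and \<open>t = s\<^sub>r\<close>.
  Its full sets of size at most two pairwise meet, so they are the sides of a triangle or share an
  element \<open>x\<close>. The triangle is excluded by counting if \<open>m > 3\<close>, and by \<open>\<ell>\<^bsub>r+1\<^esub>(\<F>) \<ge> s + \<beta>\<close> if
  \<open>m = 3\<close>.

  Otherwise let \<open>Y\<close> be the set of the \<open>y\<close> for which \<open>{x, y}\<close> is full. Fewer than \<open>s\<close> of the members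
  that avoid \<open>x\<close> can miss a given \<open>y \<in> Y\<close>, and there are at least \<open>s + \<beta>\<close> such members; double
  counting gives \<open>card Y \<le> m\<close>. If \<open>card Y < m\<close>, the family is too small by an order of magnitude
  \<open>n\<^bsup>k-2\<^esup>\<close>. If \<open>card Y = m\<close>, the double counting also bounds the number of members avoiding \<open>x\<close> by
  \<open>s + b\<close>, and it leaves so little degree outside \<open>Y\<close> that fewer than \<open>t\<close> members through \<open>x\<close> can
  miss \<open>Y\<close>.
\<close>

subsection \<open>Counting\<close>

text \<open>The \<open>k\<close>-sets that miss \<open>Z\<close> are those of \<open>V - Z\<close>.
  The identity is additive because subtraction on \<open>nat\<close> truncates; the later size
  bounds keep this shape until the last theorem.\<close>

lemma card_nsets_hitting:
  assumes "finite V" "Z \<subseteq> V"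
  shows "card {B \<in> nsets V k. B \<inter> Z \<noteq> {}} + ((card V - card Z) choose k) = card V choose k"
proof -
  have fin: "finite (nsets V k)"
    using assms(1) by (rule finite_imp_finite_nsets)
  have "nsets V k = {B \<in> nsets V k. B \<inter> Z \<noteq> {}} \<union> nsets (V - Z) k"
    by (auto simp: nsets_def)
  moreover have "{B \<in> nsets V k. B \<inter> Z \<noteq> {}} \<inter> nsets (V - Z) k = {}"
    by (auto simp: nsets_def)
  ultimately have "card (nsets V k) = card {B \<in> nsets V k. B \<inter> Z \<noteq> {}} + card (nsets (V - Z) k)"
    by (metis (no_types, lifting) card_Un_disjoint fin finite_Un)
  moreover have "card (V - Z) = card V - card Z"
    using assms by (meson card_Diff_subset finite_subset)
  ultimately show ?thesis
    using assms by simp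
qed

lemma card_nsets_superset:
  assumes "finite V" "C \<subseteq> V" "card C \<le> k"
  shows "card {B \<in> nsets V k. C \<subseteq> B} = (card V - card C) choose (k - card C)"
proof -
  have finC: "finite C" using assms finite_subset by blast
  have "bij_betw (\<lambda>D. C \<union> D) (nsets (V - C) (k - card C)) {B \<in> nsets V k. C \<subseteq> B}"
  proof (rule bij_betw_byWitness[where f' = "\<lambda>B. B - C"])
    show "(\<lambda>D. C \<union> D) ` nsets (V - C) (k - card C) \<subseteq> {B \<in> nsets V k. C \<subseteq> B}"
    proof
      fix B assume "B \<in> (\<lambda>D. C \<union> D) ` nsets (V - C) (k - card C)"
      then obtain D where D: "B = C \<union> D" "D \<subseteq> V - C" "finite D" "card D = k - card C"
        by (auto simp: nsets_def)
      then have "card B = k" using finC assms(3)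
        by (subst D(1), subst card_Un_disjoint) auto
      with D finC assms show "B \<in> {B \<in> nsets V k. C \<subseteq> B}" by (auto simp: nsets_def)
    qed
  qed (use assms finC in \<open>auto simp: nsets_def card_Diff_subset\<close>)
  then have "card {B \<in> nsets V k. C \<subseteq> B} = card (nsets (V - C) (k - card C))"
    by (rule bij_betw_same_card[symmetric])
  also have "\<dots> = (card V - card C) choose (k - card C)"
    using assms finC by (simp add: card_Diff_subset)
  finally show ?thesis .
qed

text \<open>This bounds degrees by order \<open>n^(k - card C)\<close>. The set \<open>C\<close> may
  leave \<open>V\<close>, since \<open>not_full_card_le\<close> adjoins arbitrary elements; nothing
  is counted then.\<close>

lemma card_nsets_superset_le:
  assumes "finite V" "F \<subseteq> nsets V k" "finite C" "card C \<le> k"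
  shows "card {A \<in> F. C \<subseteq> A} \<le> (card V - card C) choose (k - card C)"
proof (cases "C \<subseteq> V")
  case True
  have "card {A \<in> F. C \<subseteq> A} \<le> card {B \<in> nsets V k. C \<subseteq> B}"
    using assms finite_imp_finite_nsets[OF assms(1)] by (intro card_mono) auto
  then show ?thesis using card_nsets_superset[OF assms(1) True assms(4)] by simp
next
  case False
  then have "{A \<in> F. C \<subseteq> A} = {}" using assms(2) by (auto simp: nsets_def)
  then show ?thesis by (metis card.empty le0)
qed

text \<open>Deleting \<open>x\<close> reduces the count to \<open>card_nsets_hitting\<close> in
  \<open>V - {x}\<close> with \<open>k - 1\<close>. With \<open>Z = Y\<close> this is the main term
  of an extremal star.\<close>

lemma card_nsets_through_hitting:
  assumes "finite V" "x \<in> V" "Z \<subseteq> V - {x}" "k \<ge> 1"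
  shows "card {B \<in> nsets V k. x \<in> B \<and> B \<inter> Z \<noteq> {}} + ((card V - 1 - card Z) choose (k - 1))
           = (card V - 1) choose (k - 1)"
proof -
  have "bij_betw (insert x) {D \<in> nsets (V - {x}) (k - 1). D \<inter> Z \<noteq> {}}
          {B \<in> nsets V k. x \<in> B \<and> B \<inter> Z \<noteq> {}}"
  proof (rule bij_betw_byWitness[where f' = "\<lambda>B. B - {x}"])
    show "insert x ` {D \<in> nsets (V - {x}) (k - 1). D \<inter> Z \<noteq> {}}
            \<subseteq> {B \<in> nsets V k. x \<in> B \<and> B \<inter> Z \<noteq> {}}"
    proof
      fix B assume "B \<in> insert x ` {D \<in> nsets (V - {x}) (k - 1). D \<inter> Z \<noteq> {}}"
      then obtain D where D: "B = insert x D" "D \<subseteq> V - {x}" "finite D" "card D = k - 1" "D \<inter> Z \<noteq> {}"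
        by (auto simp: nsets_def)
      moreover have "card B = k"
        using D assms(4) by (subst D(1), subst card_insert_disjoint) auto
      ultimately show "B \<in> {B \<in> nsets V k. x \<in> B \<and> B \<inter> Z \<noteq> {}}"
        using assms(2) by (auto simp: nsets_def)
    qed
    show "(\<lambda>B. B - {x}) ` {B \<in> nsets V k. x \<in> B \<and> B \<inter> Z \<noteq> {}}
            \<subseteq> {D \<in> nsets (V - {x}) (k - 1). D \<inter> Z \<noteq> {}}"
    proof
      fix D assume "D \<in> (\<lambda>B. B - {x}) ` {B \<in> nsets V k. x \<in> B \<and> B \<inter> Z \<noteq> {}}"
      then obtain B where B: "D = B - {x}" "B \<subseteq> V" "finite B" "card B = k" "x \<in> B" "B \<inter> Z \<noteq> {}"
        by (auto simp: nsets_def)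
      then have "D \<subseteq> V - {x}" "D \<inter> Z \<noteq> {}" "card D = k - 1" "finite D"
        using assms(3) by auto
      then show "D \<in> {D \<in> nsets (V - {x}) (k - 1). D \<inter> Z \<noteq> {}}" by (simp add: nsets_def)
    qed
  qed (auto simp: nsets_def)
  then have "card {B \<in> nsets V k. x \<in> B \<and> B \<inter> Z \<noteq> {}}
               = card {D \<in> nsets (V - {x}) (k - 1). D \<inter> Z \<noteq> {}}"
    by (rule bij_betw_same_card[symmetric])
  then show ?thesis
    using card_nsets_hitting[of "V - {x}" Z "k - 1"] assms by simp
qed

section \<open>Asymptotic comparison of binomial coefficients\<close>

text \<open>\<open>n choose j\<close> is at most \<open>n ^ j\<close>, while
  \<open>(n - c) choose (j + 1)\<close> is at least a constant times \<open>n ^ (j + 1)\<close>; one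
  extra factor \<open>n\<close> beats every constant \<open>K\<close>.\<close>

lemma binomial_dominates:
  fixes K c j :: nat
  shows "\<exists>n0. \<forall>n\<ge>n0. K * (n choose j) < (n - c) choose (j + 1)"
proof (intro exI allI impI)
  \<comment> \<open>The first two summands give \<open>j + 1 \<le> N\<close> and
    \<open>n \<le> 2 * N\<close>; the third makes \<open>n\<close> exceed the constant lost in the
    lower bound.\<close>
  fix n :: nat assume n: "n \<ge> 2 * c + 2 * (j + 1) + K * (2 * (j + 1)) ^ (j + 1) + 1"
  define N where "N = n - c"
  have N: "j + 1 \<le> N" "n \<le> 2 * N" using n by (auto simp: N_def)
  have "(real N / real (j + 1)) ^ (j + 1) \<le> real (N choose (j + 1))"
    using binomial_ge_n_over_k_pow_k[OF N(1), where ?'a = real] .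
  moreover have "(real n / real (2 * (j + 1))) ^ (j + 1) \<le> (real N / real (j + 1)) ^ (j + 1)"
  proof (rule power_mono)
    have "real n \<le> 2 * real N" using N(2) by linarith
    then show "real n / real (2 * (j + 1)) \<le> real N / real (j + 1)"
      using mult_right_mono[of "real n" "2 * real N" "1 + real j"]
      by (simp add: divide_simps algebra_simps)
  qed simp
  moreover have "real K * real n ^ j < (real n / real (2 * (j + 1))) ^ (j + 1)"
  proof -
    have "K * (2 * (j + 1)) ^ (j + 1) < n" using n by linarith
    then have "real K * real (2 * (j + 1)) ^ (j + 1) < real n"
      by (metis of_nat_less_iff of_nat_mult of_nat_power)
    then have "real K * real (2 * (j + 1)) ^ (j + 1) * real n ^ j < real n * real n ^ j"
      using n by (intro mult_strict_right_mono) auto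
    then show ?thesis by (simp add: power_divide pos_less_divide_eq mult_ac)
  qed
  moreover have "real (n choose j) \<le> real n ^ j"
    using binomial_le_pow[of j n] by (cases "j \<le> n") (simp_all add: binomial_eq_0 flip: of_nat_power)
  then have "real K * real (n choose j) \<le> real K * real n ^ j"
    by (simp add: mult_left_mono)
  ultimately have "real (K * (n choose j)) < real (N choose (j + 1))"
    unfolding of_nat_mult by linarith
  then show "K * (n choose j) < (n - c) choose (j + 1)"
    unfolding N_def by (simp only: of_nat_less_iff)
qed

text \<open>Pascal's rule is applied \<open>d\<close> times, and each removed term is at most the
  largest one, \<open>(n - 1) choose j\<close>.\<close>

lemma binomial_diff_le:
  "(n choose (j + 1)) \<le> ((n - d) choose (j + 1)) + d * ((n - 1) choose j)"
proof (induction d)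
  case (Suc d)
  have "((n - d) choose (j + 1)) \<le> ((n - Suc d) choose (j + 1)) + ((n - 1) choose j)"
  proof (cases "n - d")
    case (Suc e)
    then have "(e choose j) \<le> ((n - 1) choose j)" by (intro binomial_right_mono) auto
    moreover have "n - Suc d = e" using Suc by simp
    ultimately show ?thesis using Suc by simp
  qed simp
  with Suc show ?case by simp
qed simp

text \<open>The same telescoping, with each removed term bounded below by the smallest one.\<close>

lemma binomial_diff_ge:
  assumes "d \<le> n"
  shows "((n - d) choose (j + 1)) + d * ((n - d) choose j) \<le> (n choose (j + 1))"
  using assms
proof (induction d)
  case (Suc d)
  have *: "n - d = Suc (n - Suc d)" using Suc.prems by simp
  have "((n - d) choose (j + 1)) = ((n - Suc d) choose j) + ((n - Suc d) choose (j + 1))"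
    unfolding * by simp
  moreover have "((n - Suc d) choose j) \<le> ((n - d) choose j)"
    by (intro binomial_right_mono) simp
  then have "d * ((n - Suc d) choose j) \<le> d * ((n - d) choose j)"
    by (rule mult_le_mono2)
  ultimately have "((n - Suc d) choose (j + 1)) + Suc d * ((n - Suc d) choose j)
       \<le> ((n - d) choose (j + 1)) + d * ((n - d) choose j)"
    by simp
  with Suc show ?case by simp
qed simp

subsection \<open>Full sets\<close>

text \<open>
  Full sets play the role of the kernels of large sunflowers: for large \<open>L\<close>, disjoint full sets
  extend greedily to prescribed numbers of members that are disjoint across the sets.
\<close>

definition full :: "nat \<Rightarrow> 'a set set \<Rightarrow> 'a set \<Rightarrow> bool" where
  "full L \<F> C \<longleftrightarrow>
     (\<forall>W. finite W \<and> card W \<le> L \<and> W \<inter> C = {} \<longrightarrow> (\<exists>A\<in>\<F>. C \<subseteq> A \<and> A \<inter> W = {}))"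

text \<open>Between two such families the Kneser graph has all edges.\<close>

definition cross_disjoint :: "'a set set \<Rightarrow> 'a set set \<Rightarrow> bool" where
  "cross_disjoint \<A> \<B> \<longleftrightarrow> (\<forall>A\<in>\<A>. \<forall>B\<in>\<B>. A \<inter> B = {})"

lemma card_Union_le:
  assumes "finite \<P>" "\<And>A. A \<in> \<P> \<Longrightarrow> card A \<le> k"
  shows "card (\<Union>\<P>) \<le> k * card \<P>"
proof -
  have "card (\<Union>\<P>) \<le> (\<Sum>A\<in>\<P>. card A)" by (rule card_Union_le_sum_card)
  also have "\<dots> \<le> (\<Sum>A\<in>\<P>. k)" using assms(2) by (rule sum_mono)
  finally show ?thesis by (simp add: mult.commute)
qed

text \<open>Members are picked one at a time, each avoiding \<open>W\<close> and the parts outside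
  \<open>C\<close> of those already picked; these obstacles have at most \<open>L\<close> elements
  together.\<close>

lemma full_extend:
  assumes F: "\<And>A. A \<in> \<F> \<Longrightarrow> finite A \<and> card A = k"
    and "full L \<F> C" "card C < k" "finite W" "W \<inter> C = {}" "card W + k * q \<le> L"
  shows "\<exists>\<P>\<subseteq>\<F>. finite \<P> \<and> card \<P> = q \<and> (\<forall>A\<in>\<P>. C \<subseteq> A \<and> A \<inter> W = {})"
  using assms(6)
proof (induction q)
  case 0
  show ?case by (intro exI[of _ "{}"]) simp
next
  case (Suc q)
  then obtain \<P> where P: "\<P> \<subseteq> \<F>" "card \<P> = q" "\<forall>A\<in>\<P>. C \<subseteq> A \<and> A \<inter> W = {}"
    and fin: "finite \<P>"
    by auto
  define U where "U = W \<union> (\<Union>\<P> - C)"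
    have finP: "finite (\<Union>\<P>)" using fin P(1) F by blast
    have "card (\<Union>\<P>) \<le> k * q"
using card_Union_le[of \<P> k] fin P(2) subsetD[OF P(1)] F by (metis order_refl)
    then have "card (\<Union>\<P> - C) \<le> k * q"
      by (meson Diff_subset card_mono finP le_trans)
    then have "card U \<le> L"
      using Suc.prems card_Un_le[of W "\<Union>\<P> - C"] by (simp add: U_def)
    moreover have "finite U" "U \<inter> C = {}"
      using finP assms(4,5) by (auto simp: U_def)
    ultimately obtain A where A: "A \<in> \<F>" "C \<subseteq> A" "A \<inter> U = {}"
      using assms(2) unfolding full_def by blast
    \<comment> \<open>A repeated member would lie inside \<open>C\<close>, which has fewer than
      \<open>k\<close> elements.\<close>
    have "A \<notin> \<P>"
    proof
      assume "A \<in> \<P>"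
      then have "A \<subseteq> C" using A(3) by (auto simp: U_def)
      then have "A = C" using A by blast
      then show False using F[OF A(1)] assms(3) by simp
    qed
    then have "card (insert A \<P>) = Suc q" using fin P(2) by simp
    moreover have "\<forall>B\<in>insert A \<P>. C \<subseteq> B \<and> B \<inter> W = {}"
      using A P(3) by (auto simp: U_def)
    moreover have "insert A \<P> \<subseteq> \<F>" using A(1) P(1) by simp
    ultimately show ?case using fin by blast
qed

text \<open>The induction hypothesis is applied with the last \<open>C i\<close> added to
  \<open>W\<close>, so the earlier members leave room for that set, which is then extended away from
  all of them. The \<open>1\<close> in \<open>s i + 1\<close> pays for \<open>C i\<close>
  itself.\<close>

lemma full_greedy:
  fixes s :: "nat \<Rightarrow> nat"
  assumes F: "\<And>A. A \<in> \<F> \<Longrightarrow> finite A \<and> card A = k"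
    and "\<And>i. i \<in> {1..q} \<Longrightarrow> full L \<F> (C i) \<and> finite (C i) \<and> card (C i) < k \<and> W \<inter> C i = {}"
    and "\<And>i j. i \<in> {1..q} \<Longrightarrow> j \<in> {1..q} \<Longrightarrow> i \<noteq> j \<Longrightarrow> C i \<inter> C j = {}"
    and "finite W" "card W + k * (\<Sum>i\<in>{1..q}. s i + 1) \<le> L"
  shows "\<exists>P. (\<forall>i\<in>{1..q}. P i \<subseteq> \<F> \<and> finite (P i) \<and> card (P i) = s i \<and> cross_disjoint (P i) {W} \<and>
              (\<forall>A\<in>P i. C i \<subseteq> A) \<and> (\<forall>j\<in>{1..q}. i \<noteq> j \<longrightarrow> cross_disjoint (P i) (P j)))"
  using assms(2-5)
proof (induction q arbitrary: W)
  case 0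
  then show ?case by simp
next
  case (Suc q)
  let ?C = "C (Suc q)"
  have C: "full L \<F> ?C" "finite ?C" "card ?C < k" "W \<inter> ?C = {}"
    using Suc.prems(1)[of "Suc q"] by auto
  have L: "card W + k * (\<Sum>i\<in>{1..q}. s i + 1) + k * (s (Suc q) + 1) \<le> L"
    using Suc.prems(4) by (simp add: algebra_simps)
  have "card (W \<union> ?C) \<le> card W + k"
    using card_Un_le[of W ?C] C(3) by linarith
  then have W: "card (W \<union> ?C) + k * (\<Sum>i\<in>{1..q}. s i + 1) \<le> L" using L by simp
  have "\<exists>P. \<forall>i\<in>{1..q}. P i \<subseteq> \<F> \<and> finite (P i) \<and> card (P i) = s i \<and>
      cross_disjoint (P i) {W \<union> ?C} \<and>
      (\<forall>A\<in>P i. C i \<subseteq> A) \<and> (\<forall>j\<in>{1..q}. i \<noteq> j \<longrightarrow> cross_disjoint (P i) (P j))"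
  proof (rule Suc.IH)
    fix i assume i: "i \<in> {1..q}"
    then show "full L \<F> (C i) \<and> finite (C i) \<and> card (C i) < k \<and> (W \<union> ?C) \<inter> C i = {}"
      using Suc.prems(1)[of i] Suc.prems(2)[of i "Suc q"] by (auto simp: Int_Un_distrib2 Int_commute)
    fix j assume "j \<in> {1..q}" "i \<noteq> j"
    then show "C i \<inter> C j = {}" using Suc.prems(2)[of i j] i by simp
  qed (use W Suc.prems(3) C(2) in auto)
  then obtain P where P: "\<forall>i\<in>{1..q}. P i \<subseteq> \<F> \<and> finite (P i) \<and> card (P i) = s i \<and>
      cross_disjoint (P i) {W \<union> ?C} \<and>
      (\<forall>A\<in>P i. C i \<subseteq> A) \<and> (\<forall>j\<in>{1..q}. i \<noteq> j \<longrightarrow> cross_disjoint (P i) (P j))"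
    by blast
  have Q: "P i \<subseteq> \<F>" "card (P i) = s i" "finite (P i)" "cross_disjoint (P i) {W}"
      "cross_disjoint (P i) {?C}" "\<forall>A\<in>P i. C i \<subseteq> A"
      "\<forall>j\<in>{1..q}. i \<noteq> j \<longrightarrow> cross_disjoint (P i) (P j)" if "i \<in> {1..q}" for i
    using bspec[OF P that] by (auto simp: cross_disjoint_def)
  define U where "U = W \<union> (\<Union>i\<in>{1..q}. \<Union>(P i))"
  have cardU: "card (\<Union>(P i)) \<le> k * s i" if "i \<in> {1..q}" for i
  proof -
    have "card A \<le> k" if "A \<in> P i" for A
      using that F[of A] Q(1)[OF \<open>i \<in> {1..q}\<close>] by auto
    then show ?thesis using card_Union_le[of "P i" k] Q(2,3)[OF that] by simp
  qed
  have "finite (\<Union>(P i))" if "i \<in> {1..q}" for i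
    using Q(1,3)[OF that] F by blast
  then have finU: "finite U" using Suc.prems(3) by (auto simp: U_def)
  have "card U \<le> card W + card (\<Union>i\<in>{1..q}. \<Union>(P i))" unfolding U_def by (rule card_Un_le)
  also have "card (\<Union>i\<in>{1..q}. \<Union>(P i)) \<le> (\<Sum>i\<in>{1..q}. card (\<Union>(P i)))"
    by (rule card_UN_le) simp
  also have "\<dots> \<le> (\<Sum>i\<in>{1..q}. k * s i)" using cardU by (rule sum_mono)
  also have "\<dots> \<le> (\<Sum>i\<in>{1..q}. k * (s i + 1))" by (rule sum_mono) simp
  also have "\<dots> = k * (\<Sum>i\<in>{1..q}. s i + 1)" by (simp only: sum_distrib_left)
  finally have "card U + k * s (Suc q) \<le> L" using L by simp
  moreover have "U \<inter> ?C = {}"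
    using C(4) Q(5) by (fastforce simp: U_def cross_disjoint_def)
  ultimately have "\<exists>R\<subseteq>\<F>. finite R \<and> card R = s (Suc q) \<and> (\<forall>A\<in>R. ?C \<subseteq> A \<and> A \<inter> U = {})"
    by (intro full_extend[OF F C(1,3) finU])
  then obtain R where R: "R \<subseteq> \<F>" "finite R" "card R = s (Suc q)" "\<forall>A\<in>R. ?C \<subseteq> A \<and> A \<inter> U = {}"
    by blast
  define P' where "P' = (\<lambda>i. if i = Suc q then R else P i)"
  have RQ: "cross_disjoint R (P i)" "cross_disjoint (P i) R" if "i \<in> {1..q}" for i
  proof -
    have "B \<subseteq> U" if "B \<in> P i" for B
      using that \<open>i \<in> {1..q}\<close> unfolding U_def by blast
    then show "cross_disjoint R (P i)" "cross_disjoint (P i) R"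
      using R(4) unfolding cross_disjoint_def by blast+
  qed
  have RW: "cross_disjoint R {W}" using R(4) by (auto simp: cross_disjoint_def U_def)
  have "P' i \<subseteq> \<F> \<and> finite (P' i) \<and> card (P' i) = s i \<and> cross_disjoint (P' i) {W} \<and>
          (\<forall>A\<in>P' i. C i \<subseteq> A) \<and> (\<forall>j\<in>{1..Suc q}. i \<noteq> j \<longrightarrow> cross_disjoint (P' i) (P' j))"
    if "i \<in> {1..Suc q}" for i
  proof (cases "i = Suc q")
    case True
    then show ?thesis using R RQ(1) RW by (simp add: P'_def)
  next
    case False
    then have "i \<in> {1..q}" using that by auto
    then show ?thesis using Q[of i] RQ(2)[of i] False by (simp add: P'_def)
  qed
  then show ?case by blast
qed

text \<open>A set \<open>W\<close> witnessing that \<open>C\<close> is not full meets every member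
  above \<open>C\<close>, so these members are spread over at most \<open>L\<close> one-element
  enlargements of \<open>C\<close>. The predicate \<open>P\<close> lets a side condition survive
  repeated use.\<close>

lemma not_full_card_le:
  assumes "finite \<F>" "\<not> full L \<F> C"
    and "\<And>w. w \<notin> C \<Longrightarrow> card {A \<in> \<F>. insert w C \<subseteq> A \<and> P A} \<le> D"
  shows "card {A \<in> \<F>. C \<subseteq> A \<and> P A} \<le> L * D"
proof -
  obtain W where W: "finite W" "card W \<le> L" "W \<inter> C = {}" "\<forall>A\<in>\<F>. C \<subseteq> A \<longrightarrow> A \<inter> W \<noteq> {}"
    using assms(2) unfolding full_def by auto
  have "card {A \<in> \<F>. C \<subseteq> A \<and> P A} \<le> card (\<Union>w\<in>W. {A \<in> \<F>. insert w C \<subseteq> A \<and> P A})"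
    using W(1,4) assms(1) by (intro card_mono) auto
  also have "\<dots> \<le> (\<Sum>w\<in>W. card {A \<in> \<F>. insert w C \<subseteq> A \<and> P A})"
    using W(1) by (rule card_UN_le)
  also have "\<dots> \<le> (\<Sum>w\<in>W. D)" using W(3) assms(3) by (intro sum_mono) auto
  also have "\<dots> \<le> L * D" using W(2) by simp
  finally show ?thesis .
qed

text \<open>Branching: while \<open>C\<close> has fewer than \<open>j\<close> elements, a counted
  member above \<open>C\<close> shows that \<open>C\<close> is not full, so
  \<open>not_full_card_le\<close> passes to at most \<open>L\<close> larger sets. After
  \<open>j - card C\<close> rounds only degrees of \<open>j\<close>-sets remain, of order
  \<open>n^(k - j)\<close>.\<close>

lemma card_without_full_le:
  assumes "finite V" "\<F> \<subseteq> nsets V k"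
    and "finite C" "card C \<le> j" "j \<le> k"
  shows "card {A \<in> \<F>. C \<subseteq> A \<and> (\<forall>D\<subseteq>A. card D < j \<longrightarrow> \<not> full L \<F> D)}
           \<le> L ^ (j - card C) * ((card V - j) choose (k - j))"
  using assms(3,4)
proof (induction "j - card C" arbitrary: C)
  case 0
  have finF: "finite \<F>" using assms(1,2) finite_imp_finite_nsets finite_subset by blast
  have "card {A \<in> \<F>. C \<subseteq> A \<and> (\<forall>D\<subseteq>A. card D < j \<longrightarrow> \<not> full L \<F> D)} \<le> card {A \<in> \<F>. C \<subseteq> A}"
    using finF by (intro card_mono) auto
  also have "\<dots> \<le> (card V - card C) choose (k - card C)"
    using 0 assms by (intro card_nsets_superset_le) auto
  finally show ?case using 0 by simp
next
  case (Suc d)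
  have finF: "finite \<F>" using assms(1,2) finite_imp_finite_nsets finite_subset by blast
  let ?P = "\<lambda>A. \<forall>D\<subseteq>A. card D < j \<longrightarrow> \<not> full L \<F> D"
  show ?case
  proof (cases "full L \<F> C")
    case True
    then have "{A \<in> \<F>. C \<subseteq> A \<and> ?P A} = {}" using Suc by auto
    then show ?thesis by (metis (no_types, lifting) card.empty le0)
  next
    case False
    have "card {A \<in> \<F>. C \<subseteq> A \<and> ?P A} \<le> L * (L ^ d * ((card V - j) choose (k - j)))"
    proof (rule not_full_card_le[OF finF False])
      fix w assume "w \<notin> C"
      then have c: "card (insert w C) = Suc (card C)" using Suc by simp
      then have d: "d = j - card (insert w C)" using Suc by simp
      show "card {A \<in> \<F>. insert w C \<subseteq> A \<and> ?P A} \<le> L ^ d * ((card V - j) choose (k - j))"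
        using Suc.hyps(1)[OF d] Suc c d by simp
    qed
    then show ?thesis unfolding Suc.hyps(2)[symmetric] by simp
  qed
qed

subsection \<open>The parameters \<open>m\<close> and \<open>b\<close>\<close>

text \<open>Splitting off \<open>(c + 1) * k\<close> makes visible that the quotient is at least
  \<open>k\<close> and does not increase with \<open>c\<close>.\<close>

lemma quotient_eq:
  fixes s c k :: nat
  assumes "s \<ge> 1"
  shows "(s + c) * k div (c + 1) = k + (s - 1) * k div (c + 1)"
proof -
  have "(s + c) * k = (s - 1) * k + (c + 1) * k"
    using assms by (cases s) (simp_all add: algebra_simps)
  then show ?thesis by (simp only: div_mult_self2)
qed

lemma quotient_antimono:
  fixes s c k :: nat
  assumes "s \<ge> 1" "c \<le> d"
  shows "(s + d) * k div (d + 1) \<le> (s + c) * k div (c + 1)"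
  using assms by (simp only: quotient_eq) (simp add: div_le_mono2)

text \<open>The maximum in \<open>beta_hat\<close> exists: for \<open>c > (s - 1) * k\<close> the
  quotient is exactly \<open>k\<close>, so if \<open>m > k\<close> all candidates are
  bounded.\<close>

lemma beta_hat_props:
  fixes s k \<beta> :: nat
  assumes "s \<ge> 1"
  defines "m \<equiv> (s + \<beta>) * k div (\<beta> + 1)" and "b \<equiv> beta_hat k s \<beta>"
  shows "\<beta> \<le> b" and "(s + b) * k div (b + 1) = m"
    and "m > k \<Longrightarrow> (s + c) * k div (c + 1) = m \<Longrightarrow> c \<le> b"
    and "m = k \<Longrightarrow> b = \<beta>"
proof -
  have bound: "c \<le> (s - 1) * k" if "m > k" "(s + c) * k div (c + 1) = m" for c
  proof (rule ccontr)
    assume "\<not> c \<le> (s - 1) * k"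
    then have "(s - 1) * k div (c + 1) = 0" by simp
    then show False using that quotient_eq[OF assms(1), of c k] by simp
  qed
  have b: "b = (GREATEST c. (s + c) * k div (c + 1) = m)" if "m > k"
    using that by (simp add: b_def beta_hat_def m_def)
  show "(s + b) * k div (b + 1) = m"
  proof (cases "m > k")
    case True
    show ?thesis unfolding b[OF True]
      by (rule GreatestI_nat[where k = \<beta> and b = "(s - 1) * k"]) (use bound True m_def in auto)
  next
    case False
    then show ?thesis by (simp add: b_def beta_hat_def m_def)
  qed
  show *: "c \<le> b" if "m > k" "(s + c) * k div (c + 1) = m" for c
    unfolding b[OF that(1)]
    by (rule Greatest_le_nat[where b = "(s - 1) * k"]) (use bound that in auto)
  show "b = \<beta>" if "m = k" using that by (simp add: b_def beta_hat_def m_def)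
  show "\<beta> \<le> b"
  proof (cases "m > k")
    case True
    then show ?thesis using *[of \<beta>] m_def by simp
  next
    case False
    then show ?thesis by (simp add: b_def beta_hat_def m_def)
  qed
qed

subsection \<open>Double counting\<close>

lemma sum_card_swap:
  assumes "finite I" "finite Y"
  shows "(\<Sum>i\<in>I. card {y \<in> Y. R i y}) = (\<Sum>y\<in>Y. card {i \<in> I. R i y})"
proof -
  have "(\<Sum>i\<in>I. card {y \<in> Y. R i y}) = (\<Sum>i\<in>I. \<Sum>y\<in>Y. if R i y then 1 else 0)"
    using assms by (simp add: sum.If_cases Int_def)
  also have "\<dots> = (\<Sum>y\<in>Y. \<Sum>i\<in>I. if R i y then 1 else 0)" by (rule sum.swap)
  also have "\<dots> = (\<Sum>y\<in>Y. card {i \<in> I. R i y})"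
    using assms by (simp add: sum.If_cases Int_def)
  finally show ?thesis .
qed

text \<open>Incidences between \<open>Y\<close> and the \<open>A i\<close> are counted twice. The
  elements outside \<open>Y\<close> are kept as a second summand because their scarcity is exploited
  when \<open>Y\<close> is as large as possible.\<close>

lemma sum_degree_le:
  assumes "finite I" "\<And>i. i \<in> I \<Longrightarrow> finite (A i) \<and> card (A i) = k"
    and "finite Y" "\<And>y. y \<in> Y \<Longrightarrow> d \<le> card {i \<in> I. y \<in> A i}"
  shows "card Y * d + (\<Sum>i\<in>I. card (A i - Y)) \<le> card I * k"
proof -
  have "card Y * d \<le> (\<Sum>y\<in>Y. card {i \<in> I. y \<in> A i})"
    using sum_mono[of Y "\<lambda>_. d"] assms(4) by simp
  also have "\<dots> = (\<Sum>i\<in>I. card {y \<in> Y. y \<in> A i})"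
    using sum_card_swap[OF assms(1,3), of "\<lambda>i y. y \<in> A i"] by simp
  also have "\<dots> = (\<Sum>i\<in>I. card (A i \<inter> Y))"
    by (rule sum.cong) (simp_all add: Int_def conj_commute)
  finally have "card Y * d + (\<Sum>i\<in>I. card (A i - Y)) \<le> (\<Sum>i\<in>I. card (A i \<inter> Y) + card (A i - Y))"
    by (simp add: sum.distrib)
  also have "\<dots> = (\<Sum>i\<in>I. k)"
  proof (rule sum.cong)
    fix i assume "i \<in> I"
    then show "card (A i \<inter> Y) + card (A i - Y) = k"
      using assms(2)[of i] card_Diff_subset_Int[of "A i" Y] card_mono[of "A i" "A i \<inter> Y"]
      by (simp add: finite_subset)
  qed simp
  finally show ?thesis by simp
qed

text \<open>
  If \<open>Y\<close> has the largest size that the degree bound allows, then the elements outside \<open>Y\<close> together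
  lie in fewer than \<open>d\<close> of the sets.
\<close>

lemma card_meeting_outside_lt:
  assumes "finite I" "\<And>i. i \<in> I \<Longrightarrow> finite (A i) \<and> card (A i) = k"
    and "finite Y" "\<And>y. y \<in> Y \<Longrightarrow> d \<le> card {i \<in> I. y \<in> A i}"
    and "card I * k < (card Y + 1) * d" "Z \<inter> Y = {}"
  shows "card {i \<in> I. Z \<inter> A i \<noteq> {}} < d"
proof -
  have "card {i \<in> I. Z \<inter> A i \<noteq> {}} = (\<Sum>i\<in>{i \<in> I. Z \<inter> A i \<noteq> {}}. 1)" by simp
  also have "\<dots> \<le> (\<Sum>i\<in>{i \<in> I. Z \<inter> A i \<noteq> {}}. card (A i - Y))"
  proof (rule sum_mono)
    fix i assume "i \<in> {i \<in> I. Z \<inter> A i \<noteq> {}}"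
    then have "finite (A i - Y)" "A i - Y \<noteq> {}" using assms(2,6) by auto
    then show "1 \<le> card (A i - Y)" by (metis One_nat_def Suc_leI card_gt_0_iff)
  qed
  also have "\<dots> \<le> (\<Sum>i\<in>I. card (A i - Y))"
    using assms(1) by (intro sum_mono2) auto
  finally show ?thesis
    using sum_degree_le[OF assms(1-4)] assms(5) by simp
qed

subsection \<open>Families without two large cross-disjoint subfamilies\<close>

text \<open>This is the situation of the last two parts, of sizes \<open>s\<close> and
  \<open>t\<close>, once the others have been split off. The bound \<open>L\<close> leaves room for
  \<open>s + t\<close> members and one further set of at most \<open>k\<close> elements.\<close>

locale biclique_free =
  fixes V :: "'a set" and \<F> :: "'a set set" and k s t L :: nat
  assumes finV: "finite V" and F: "\<F> \<subseteq> nsets V k"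
    and k: "3 \<le> k" and s: "1 \<le> s" and t: "1 \<le> t"
    and free: "\<And>\<S> \<T>. \<S> \<subseteq> \<F> \<Longrightarrow> \<T> \<subseteq> \<F> \<Longrightarrow> card \<S> = s \<Longrightarrow> card \<T> = t \<Longrightarrow> \<not> cross_disjoint \<S> \<T>"
    and L: "k * (s + t + 1) \<le> L"
begin

lemma finF: "finite \<F>"
  using F finV finite_imp_finite_nsets finite_subset by blast

lemma mem: "A \<in> \<F> \<Longrightarrow> finite A \<and> card A = k"
  using F by (auto simp: nsets_def)

lemma mem_subset: "A \<in> \<F> \<Longrightarrow> A \<subseteq> V"
  using F by (auto simp: nsets_def)

lemma full_subset:
  assumes "full L \<F> C"
  shows "C \<subseteq> V"
proof -
  obtain A where "A \<in> \<F>" "C \<subseteq> A"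
    using assms unfolding full_def by (metis card.empty empty_iff finite.emptyI inf_bot_left le0)
  then show ?thesis using mem_subset by blast
qed

text \<open>Otherwise \<open>s\<close> members miss \<open>C\<close>, and extending \<open>C\<close>
  to \<open>t\<close> members that avoid their union yields a forbidden pair of families.\<close>

lemma card_missing_full_less:
  assumes "full L \<F> C" "card C < k"
  shows "card {A \<in> \<F>. A \<inter> C = {}} < s"
proof (rule ccontr)
  assume "\<not> ?thesis"
  then obtain \<S> where S: "\<S> \<subseteq> {A \<in> \<F>. A \<inter> C = {}}" "card \<S> = s"
    by (meson obtain_subset_with_card_n not_less)
  have finS: "finite \<S>" using S(2) s by (simp add: card_ge_0_finite)
  have "card (\<Union>\<S>) \<le> k * s"
    using card_Union_le[OF finS, of k] S mem by auto
  then have "card (\<Union>\<S>) + k * t \<le> L"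
    using L by (simp add: distrib_left)
  moreover have "finite (\<Union>\<S>)" "\<Union>\<S> \<inter> C = {}" using finS S mem by auto
  ultimately have "\<exists>\<T>\<subseteq>\<F>. finite \<T> \<and> card \<T> = t \<and> (\<forall>A\<in>\<T>. C \<subseteq> A \<and> A \<inter> \<Union>\<S> = {})"
    using assms by (intro full_extend[OF mem])
  then obtain \<T> where "\<T> \<subseteq> \<F>" "card \<T> = t" "\<forall>A\<in>\<T>. A \<inter> \<Union>\<S> = {}" by blast
  moreover from this(3) have "cross_disjoint \<S> \<T>" by (auto simp: cross_disjoint_def)
  ultimately show False using free[of \<S> \<T>] S by blast
qed

text \<open>If \<open>C\<close> and \<open>D\<close> were disjoint, \<open>C\<close> would extend to
  \<open>s\<close> members missing \<open>D\<close>, too many for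
  \<open>card_missing_full_less\<close>.\<close>

lemma full_meet:
  assumes "full L \<F> C" "full L \<F> D" "finite C" "finite D" "card C < k" "card D < k"
  shows "C \<inter> D \<noteq> {}"
proof
  assume disj: "C \<inter> D = {}"
  have "card D + k * s \<le> L" using assms(6) L by (simp add: distrib_left)
  then have "\<exists>\<S>\<subseteq>\<F>. finite \<S> \<and> card \<S> = s \<and> (\<forall>A\<in>\<S>. C \<subseteq> A \<and> A \<inter> D = {})"
    using assms disj by (intro full_extend[OF mem]) auto
  then obtain \<S> where "\<S> \<subseteq> \<F>" "card \<S> = s" "\<forall>A\<in>\<S>. A \<inter> D = {}" by blast
  then have "\<S> \<subseteq> {A \<in> \<F>. A \<inter> D = {}}" "card \<S> = s" by auto
  moreover have "finite {A \<in> \<F>. A \<inter> D = {}}" using finF by simp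
  ultimately show False
    using card_missing_full_less[OF assms(2,6)] card_mono by (metis not_less)
qed

text \<open>Pairwise meeting sets of size at most two without a common element contain a triangle.
  If no small set is full, the first alternative holds vacuously at any point of
  \<open>V\<close>.\<close>

lemma star_or_triangle:
  assumes "V \<noteq> {}"
  shows "(\<exists>x\<in>V. \<forall>C. finite C \<longrightarrow> card C \<le> 2 \<longrightarrow> full L \<F> C \<longrightarrow> x \<in> C) \<or>
    (\<exists>u v w. u \<noteq> v \<and> u \<noteq> w \<and> v \<noteq> w \<and> full L \<F> {u, v} \<and> full L \<F> {u, w} \<and> full L \<F> {v, w})"
    (is "?star \<or> ?triangle")
proof (rule ccontr)
  assume contra: "\<not> (?star \<or> ?triangle)"
  define small where "small = (\<lambda>C. finite C \<and> card C \<le> 2 \<and> full L \<F> C)"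
  have meet: "C \<inter> D \<noteq> {}" if "small C" "small D" for C D
    using that full_meet[of C D] k by (auto simp: small_def)
  have sub: "C \<subseteq> V" if "small C" for C
    using that full_subset by (auto simp: small_def)
  have avoid: "\<exists>C. small C \<and> x \<notin> C" if "x \<in> V" for x
    using contra that unfolding small_def by blast
  \<comment> \<open>The element of a full singleton would lie in every small full set, so only pairs
    remain.\<close>
  have two: "\<exists>y z. C = {y, z} \<and> y \<noteq> z" if "small C" for C
  proof -
    have "C \<noteq> {}" using meet[OF that that] by auto
    moreover have "card C \<noteq> 1"
    proof
      assume "card C = 1"
      then obtain x where "C = {x}" by (auto simp: card_1_singleton_iff)
      then show False using meet[OF that] avoid[of x] sub[OF that] by blast
    qed
    moreover have "finite C" "card C \<le> 2" using that by (auto simp: small_def)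
    ultimately have "card C = 2" by (metis One_nat_def Suc_1 card_gt_0_iff le_SucE le_antisym Suc_leI)
    then show ?thesis by (simp add: card_2_iff)
  qed
  from assms avoid obtain C where C: "small C" by blast
  then obtain u v where uv: "C = {u, v}" "u \<noteq> v" using two by blast
  then have "u \<in> V" "v \<in> V" using sub[OF C] by auto
  \<comment> \<open>\<open>D\<close> avoids \<open>u\<close> but meets \<open>{u, v}\<close>, so it
    contains \<open>v\<close>; likewise \<open>E\<close> contains \<open>u\<close>. Their common
    element must then be the third vertex.\<close>
  then obtain D E where D: "small D" "u \<notin> D" and E: "small E" "v \<notin> E" using avoid by meson
  obtain w where w: "D = {v, w}" "w \<noteq> v" "w \<noteq> u"
    using two[OF D(1)] meet[OF C D(1)] D(2) uv by auto
  obtain w' where w': "E = {u, w'}" "w' \<noteq> u" "w' \<noteq> v"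
    using two[OF E(1)] meet[OF C E(1)] E(2) uv by auto
  have "w' = w" using meet[OF D(1) E(1)] w w' uv by auto
  then have "full L \<F> {u, v}" "full L \<F> {u, w}" "full L \<F> {v, w}"
    using C D(1) E(1) uv(1) w(1) w'(1) by (simp_all add: small_def)
  then have ?triangle
    using uv(2) w(2,3) by (intro exI[of _ u] exI[of _ v] exI[of _ w]) simp
  then show False using contra by blast
qed

text \<open>Fix \<open>s\<close> members that avoid \<open>x\<close>, with union \<open>U\<close>.
  Fewer than \<open>t\<close> members through \<open>x\<close> miss \<open>U\<close>; the others
  through \<open>x\<close> contain a pair \<open>{x, u}\<close> with \<open>u\<close> in
  \<open>U\<close>, of low degree unless \<open>u\<close> lies in \<open>Y\<close>; members avoiding
  \<open>x\<close> contain no full set of size at most two. Only pairs from \<open>Y\<close>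
  contribute at order \<open>n^(k - 2)\<close>.\<close>

lemma star_card_le:
  assumes star: "\<And>C. finite C \<Longrightarrow> card C \<le> 2 \<Longrightarrow> full L \<F> C \<Longrightarrow> x \<in> C"
    and a: "s \<le> card {A \<in> \<F>. x \<notin> A}"
  defines "Y \<equiv> {y. y \<noteq> x \<and> full L \<F> {x, y}}"
  shows "card \<F> \<le> card Y * ((card V - 2) choose (k - 2))
           + (k * s * L + L ^ 3) * ((card V - 3) choose (k - 3)) + t"
proof -
  let ?p = "(card V - 2) choose (k - 2)" and ?q = "(card V - 3) choose (k - 3)"
  have finY: "finite Y" using full_subset finV finite_subset[of Y V] by (auto simp: Y_def)
  obtain \<S> where S: "\<S> \<subseteq> {A \<in> \<F>. x \<notin> A}" "card \<S> = s"
    using a by (meson obtain_subset_with_card_n)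
  have finS: "finite \<S>" using S(2) s by (simp add: card_ge_0_finite)
  define U where "U = \<Union>\<S>"
  have U: "finite U" "x \<notin> U" using S finS mem by (auto simp: U_def)
  have cU: "card U \<le> k * s" unfolding U_def
    using card_Union_le[OF finS, of k] S mem by auto
  have "card {A \<in> \<F>. x \<in> A \<and> A \<inter> U = {}} < t"
  proof (rule ccontr)
    assume "\<not> ?thesis"
    then obtain \<T> where T: "\<T> \<subseteq> {A \<in> \<F>. x \<in> A \<and> A \<inter> U = {}}" "card \<T> = t"
      by (meson obtain_subset_with_card_n not_less)
    then have "cross_disjoint \<S> \<T>" by (auto simp: cross_disjoint_def U_def)
    then show False using free[of \<S> \<T>] S T by blast
  qed
  moreover have "card {A \<in> \<F>. {x, y} \<subseteq> A} \<le> ?p" if "y \<noteq> x" for y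
    using card_nsets_superset_le[OF finV F, of "{x, y}"] that k by (simp add: card_insert_if numeral_2_eq_2)
  then have "card (\<Union>y\<in>Y. {A \<in> \<F>. {x, y} \<subseteq> A}) \<le> card Y * ?p"
    using finY card_UN_le[OF finY, of "\<lambda>y. {A \<in> \<F>. {x, y} \<subseteq> A}"]
      sum_mono[of Y "\<lambda>y. card {A \<in> \<F>. {x, y} \<subseteq> A}" "\<lambda>_. ?p"]
    by (force simp: Y_def)
  moreover have "card {A \<in> \<F>. {x, u} \<subseteq> A} \<le> L * ?q" if "u \<in> U - Y" for u
  proof -
    have ux: "u \<noteq> x" using that U by auto
    then have nf: "\<not> full L \<F> {x, u}" using that by (auto simp: Y_def)
    have "card {A \<in> \<F>. {x, u} \<subseteq> A \<and> True} \<le> L * ?q"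
    proof (rule not_full_card_le[OF finF nf])
      fix w assume "w \<notin> {x, u}"
      then have "card (insert w {x, u}) = 3" using ux by auto
      then show "card {A \<in> \<F>. insert w {x, u} \<subseteq> A \<and> True} \<le> ?q"
        using card_nsets_superset_le[OF finV F, of "insert w {x, u}"] k by simp
    qed
    then show ?thesis by simp
  qed
  then have "card (\<Union>u\<in>U - Y. {A \<in> \<F>. {x, u} \<subseteq> A}) \<le> card (U - Y) * (L * ?q)"
    using U card_UN_le[of "U - Y" "\<lambda>y. {A \<in> \<F>. {x, y} \<subseteq> A}"]
      sum_mono[of "U - Y" "\<lambda>y. card {A \<in> \<F>. {x, y} \<subseteq> A}" "\<lambda>_. L * ?q"]
    by force
  moreover have "card (U - Y) * (L * ?q) \<le> k * s * (L * ?q)"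
    using cU card_mono[of U "U - Y"] U(1) by (intro mult_le_mono1) auto
  moreover have "card {A \<in> \<F>. x \<notin> A} \<le> L ^ 3 * ?q"
  proof -
    have "{A \<in> \<F>. x \<notin> A} \<subseteq> {A \<in> \<F>. {} \<subseteq> A \<and> (\<forall>D\<subseteq>A. card D < 3 \<longrightarrow> \<not> full L \<F> D)}"
    proof
      fix A assume A: "A \<in> {A \<in> \<F>. x \<notin> A}"
      have "\<not> full L \<F> D" if "D \<subseteq> A" "card D < 3" for D
        using star[of D] that A mem[of A] finite_subset[of D A] by auto
      then show "A \<in> {A \<in> \<F>. {} \<subseteq> A \<and> (\<forall>D\<subseteq>A. card D < 3 \<longrightarrow> \<not> full L \<F> D)}"
        using A by simp
    qed
    then have "card {A \<in> \<F>. x \<notin> A}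
        \<le> card {A \<in> \<F>. {} \<subseteq> A \<and> (\<forall>D\<subseteq>A. card D < 3 \<longrightarrow> \<not> full L \<F> D)}"
      using finF by (intro card_mono) auto
    also have "\<dots> \<le> L ^ 3 * ?q"
      using card_without_full_le[OF finV F, of "{}" 3 L] k by simp
    finally show ?thesis .
  qed
  moreover have "card \<F> \<le> card {A \<in> \<F>. x \<notin> A} + (card {A \<in> \<F>. x \<in> A \<and> A \<inter> U = {}}
      + (card (\<Union>y\<in>Y. {A \<in> \<F>. {x, y} \<subseteq> A}) + card (\<Union>u\<in>U - Y. {A \<in> \<F>. {x, u} \<subseteq> A})))"
  proof -
    have "\<F> \<subseteq> {A \<in> \<F>. x \<notin> A} \<union> ({A \<in> \<F>. x \<in> A \<and> A \<inter> U = {}}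
      \<union> ((\<Union>y\<in>Y. {A \<in> \<F>. {x, y} \<subseteq> A}) \<union> (\<Union>u\<in>U - Y. {A \<in> \<F>. {x, u} \<subseteq> A})))"
      by auto
    then have "card \<F> \<le> card ({A \<in> \<F>. x \<notin> A} \<union> ({A \<in> \<F>. x \<in> A \<and> A \<inter> U = {}}
      \<union> ((\<Union>y\<in>Y. {A \<in> \<F>. {x, y} \<subseteq> A}) \<union> (\<Union>u\<in>U - Y. {A \<in> \<F>. {x, u} \<subseteq> A}))))"
      using finF finY U(1) by (intro card_mono) auto
    then show ?thesis by (meson add_left_mono card_Un_le le_trans)
  qed
  moreover have "(k * s * L + L ^ 3) * ?q = k * s * (L * ?q) + L ^ 3 * ?q"
    by (simp only: distrib_right mult.assoc)
  ultimately show ?thesis by linarith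
qed

text \<open>Fewer than \<open>s\<close> members miss a given side, and a member meeting all three
  sides contains two vertices; any two such members meet. The second claim serves the case
  \<open>m = 3\<close>, where the order of growth does not decide.\<close>

lemma triangle_card_le:
  assumes "u \<noteq> v" "u \<noteq> w" "v \<noteq> w" "full L \<F> {u, v}" "full L \<F> {u, w}" "full L \<F> {v, w}"
  shows "card \<F> \<le> 3 * ((card V - 2) choose (k - 2)) + 3 * (s - 1)"
    and "\<exists>\<R>\<subseteq>\<F>. card \<R> \<le> 3 * (s - 1) \<and> (\<forall>A\<in>\<F> - \<R>. \<forall>B\<in>\<F> - \<R>. A \<inter> B \<noteq> {})"
proof -
  let ?p = "(card V - 2) choose (k - 2)"
  define R where "R = (\<lambda>y z. {A \<in> \<F>. A \<inter> {y, z} = {}})"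
  define \<R> where "\<R> = R u v \<union> (R u w \<union> R v w)"
  have "card (R u v) \<le> s - 1" "card (R u w) \<le> s - 1" "card (R v w) \<le> s - 1"
    using card_missing_full_less[of "{u, v}"] card_missing_full_less[of "{u, w}"]
      card_missing_full_less[of "{v, w}"] assms k by (simp_all add: R_def)
  then have cR: "card \<R> \<le> 3 * (s - 1)"
    unfolding \<R>_def using card_Un_le[of "R u v" "R u w \<union> R v w"] card_Un_le[of "R u w" "R v w"] by linarith
  have out: "{u, v} \<subseteq> A \<or> {u, w} \<subseteq> A \<or> {v, w} \<subseteq> A" if "A \<in> \<F> - \<R>" for A
    using that by (auto simp: \<R>_def R_def)
  have "A \<inter> B \<noteq> {}" if "A \<in> \<F> - \<R>" "B \<in> \<F> - \<R>" for A B
    using out[OF that(1)] out[OF that(2)] by auto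
  moreover have "\<R> \<subseteq> \<F>" by (auto simp: \<R>_def R_def)
  ultimately show "\<exists>\<R>\<subseteq>\<F>. card \<R> \<le> 3 * (s - 1) \<and> (\<forall>A\<in>\<F> - \<R>. \<forall>B\<in>\<F> - \<R>. A \<inter> B \<noteq> {})"
    using cR by blast
  define Q where "Q = (\<lambda>y z. {A \<in> \<F>. {y, z} \<subseteq> A})"
  have Q: "card (Q y z) \<le> ?p" if "y \<noteq> z" for y z
    using card_nsets_superset_le[OF finV F, of "{y, z}"] that k by (simp add: Q_def card_insert_if numeral_2_eq_2)
  have "\<F> \<subseteq> \<R> \<union> (Q u v \<union> (Q u w \<union> Q v w))" using out by (auto simp: Q_def)
  moreover have "finite (\<R> \<union> (Q u v \<union> (Q u w \<union> Q v w)))"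
    using finF by (auto simp: Q_def \<R>_def R_def)
  ultimately have "card \<F> \<le> card (\<R> \<union> (Q u v \<union> (Q u w \<union> Q v w)))" by (rule card_mono[rotated])
  also have "\<dots> \<le> card \<R> + (card (Q u v) + (card (Q u w) + card (Q v w)))"
    by (meson add_left_mono card_Un_le le_trans)
  finally show "card \<F> \<le> 3 * ?p + 3 * (s - 1)"
    using cR Q[OF assms(1)] Q[OF assms(2)] Q[OF assms(3)] by linarith
qed

end

subsection \<open>The bipartite case\<close>

context biclique_free
begin

text \<open>Each \<open>y\<close> in \<open>Y\<close> is missed by fewer than \<open>s\<close> of
  the members avoiding \<open>x\<close>, so its degree among them is large. Double counting forces
  \<open>card Y\<close> to be exactly \<open>m\<close>, and this tightness gives the last
  bounds.\<close>

lemma star_structure: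
  fixes x :: 'a and \<beta> :: nat
  defines "\<A> \<equiv> {A \<in> \<F>. x \<notin> A}" and "Y \<equiv> {y. y \<noteq> x \<and> full L \<F> {x, y}}"
    and "m \<equiv> (s + \<beta>) * k div (\<beta> + 1)" and "b \<equiv> beta_hat k s \<beta>"
  assumes a: "s + \<beta> \<le> card \<A>" and mY: "m \<le> card Y"
  shows "Y \<subseteq> V - {x}" and "card Y = m" and "card \<A> \<le> s + b"
    and "\<And>y. y \<in> Y \<Longrightarrow> card \<A> - s + 1 \<le> card {A \<in> \<A>. y \<in> A}"
    and "card {G \<in> \<F>. x \<in> G \<and> G \<inter> Y = {}} < t"
proof -
  \<comment> \<open>\<open>c\<close> is the actual excess over \<open>s\<close>. It takes the role
    of \<open>\<beta>\<close> in the double count and proves to give the same quotient.\<close>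
  define c where "c = card \<A> - s"
  have c: "\<beta> \<le> c" "card \<A> = s + c" using a by (auto simp: c_def)
  show sub: "Y \<subseteq> V - {x}" using full_subset by (auto simp: Y_def)
  then have finY: "finite Y" using finV finite_subset by blast
  have finA: "finite \<A>" using finF by (simp add: \<A>_def)
  have memA: "finite A \<and> card A = k" if "A \<in> \<A>" for A using mem that by (auto simp: \<A>_def)
  have miss: "card {A \<in> \<A>. y \<notin> A} < s" if "y \<in> Y" for y
  proof -
    have "card {A \<in> \<F>. A \<inter> {x, y} = {}} < s"
      using that k by (intro card_missing_full_less) (auto simp: Y_def card_insert_if)
    moreover have "{A \<in> \<A>. y \<notin> A} = {A \<in> \<F>. A \<inter> {x, y} = {}}" by (auto simp: \<A>_def)
    ultimately show ?thesis by simp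
  qed
  have deg: "c + 1 \<le> card {A \<in> \<A>. y \<in> A}" if "y \<in> Y" for y
  proof -
    have "card \<A> = card {A \<in> \<A>. y \<in> A} + card {A \<in> \<A>. y \<notin> A}"
      using finA by (subst card_Un_disjoint[symmetric]) (auto intro: arg_cong[where f = card])
    then show ?thesis using miss[OF that] c(2) by linarith
  qed
  then show "card \<A> - s + 1 \<le> card {A \<in> \<A>. y \<in> A}" if "y \<in> Y" for y
    using that by (simp add: c_def)
  have "card Y * (c + 1) \<le> (s + c) * k"
    using sum_degree_le[OF finA memA finY deg] c(2) by simp
  then have "card Y \<le> (s + c) * k div (c + 1)"
    by (metis div_le_mono nonzero_mult_div_cancel_right add_is_0 one_neq_zero)
  moreover have "(s + c) * k div (c + 1) \<le> m"
    unfolding m_def by (rule quotient_antimono[OF s c(1)])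
  ultimately have cY: "card Y = m" and fc: "(s + c) * k div (c + 1) = m"
    using mY by simp_all
  show "card Y = m" by (rule cY)
  \<comment> \<open>The surplus of incidences is a remainder modulo \<open>c + 1\<close>, hence
    smaller than the degree bound \<open>c + 1\<close>, as \<open>card_meeting_outside_lt\<close>
    requires.\<close>
  have "card \<A> * k < (card Y + 1) * (c + 1)"
    unfolding cY c(2) fc[symmetric] using dividend_less_div_times[of "c + 1" "(s + c) * k"]
    by (simp add: algebra_simps)
  note outside = card_meeting_outside_lt[OF finA memA finY deg this]
  note bh = beta_hat_props[OF s, where k = k and \<beta> = \<beta>, folded m_def b_def]
  show "card \<A> \<le> s + b"
  proof (cases "m > k")
    case True
    then show ?thesis using bh(3)[OF True fc] c(2) by simp
  next
    case False
    \<comment> \<open>For \<open>m = k\<close> the value of \<open>beta_hat\<close> is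
      \<open>\<beta>\<close>, with no maximality to use. Here
      \<open>(s - 1) * k \<le> \<beta>\<close>; at most one member contains the \<open>k\<close>-set
      \<open>Y\<close>, and at most \<open>k * (s - 1)\<close> of those in \<open>\<A>\<close> miss
      an element of it.\<close>
    have "k + (s - 1) * k div (\<beta> + 1) = m" unfolding m_def using quotient_eq[OF s, of \<beta> k] by simp
    then have mk: "m = k" "(s - 1) * k div (\<beta> + 1) = 0" using False by auto
    then have \<beta>: "(s - 1) * k \<le> \<beta>" by (simp add: div_eq_0_iff)
    have "card {A \<in> \<A>. Y \<subseteq> A} \<le> 1"
    proof -
      have "A = Y" if "A \<in> \<A>" "Y \<subseteq> A" for A
        using that memA[OF that(1)] cY mk(1) by (metis card_subset_eq)
      then have "{A \<in> \<A>. Y \<subseteq> A} \<subseteq> {Y}" by auto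
      then show ?thesis by (metis card_mono finite.emptyI finite.insertI is_singletonI is_singleton_altdef)
    qed
    moreover have "card (\<Union>y\<in>Y. {A \<in> \<A>. y \<notin> A}) \<le> k * (s - 1)"
    proof -
      have "card (\<Union>y\<in>Y. {A \<in> \<A>. y \<notin> A}) \<le> (\<Sum>y\<in>Y. card {A \<in> \<A>. y \<notin> A})"
        using finY by (rule card_UN_le)
      also have "\<dots> \<le> (\<Sum>y\<in>Y. s - 1)"
      proof (rule sum_mono)
        fix y assume "y \<in> Y"
        then show "card {A \<in> \<A>. y \<notin> A} \<le> s - 1" using miss[of y] by linarith
      qed
      finally show ?thesis using cY mk(1) by simp
    qed
    moreover have "card \<A> \<le> card {A \<in> \<A>. Y \<subseteq> A} + card (\<Union>y\<in>Y. {A \<in> \<A>. y \<notin> A})"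
    proof -
      have "\<A> \<subseteq> {A \<in> \<A>. Y \<subseteq> A} \<union> (\<Union>y\<in>Y. {A \<in> \<A>. y \<notin> A})" by blast
      then have "card \<A> \<le> card ({A \<in> \<A>. Y \<subseteq> A} \<union> (\<Union>y\<in>Y. {A \<in> \<A>. y \<notin> A}))"
        using finA finY by (intro card_mono) auto
      then show ?thesis by (meson card_Un_le le_trans)
    qed
    ultimately have "card \<A> \<le> 1 + \<beta>" using \<beta> by (simp add: mult.commute)
    then show ?thesis using s bh(1) by simp
  qed
  show "card {G \<in> \<F>. x \<in> G \<and> G \<inter> Y = {}} < t"
  proof (rule ccontr)
    assume "\<not> ?thesis"
    then obtain \<T> where T: "\<T> \<subseteq> {G \<in> \<F>. x \<in> G \<and> G \<inter> Y = {}}" "card \<T> = t"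
      by (meson obtain_subset_with_card_n not_less)
    \<comment> \<open>The union of \<open>t\<close> members missing \<open>Y\<close> meets at most
      \<open>c\<close> of the \<open>s + c\<close> members avoiding \<open>x\<close>, so
      \<open>s\<close> of these are left for a forbidden pair.\<close>
    have "card {A \<in> \<A>. \<Union>\<T> \<inter> A \<noteq> {}} < c + 1"
      using T by (intro outside) auto
    moreover have "card \<A> = card {A \<in> \<A>. \<Union>\<T> \<inter> A \<noteq> {}} + card {A \<in> \<A>. \<Union>\<T> \<inter> A = {}}"
      using finA by (subst card_Un_disjoint[symmetric]) (auto intro: arg_cong[where f = card])
    ultimately have "s \<le> card {A \<in> \<A>. \<Union>\<T> \<inter> A = {}}" using c(2) by linarith
    then obtain \<S> where S: "\<S> \<subseteq> {A \<in> \<A>. \<Union>\<T> \<inter> A = {}}" "card \<S> = s"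
      by (meson obtain_subset_with_card_n)
    then have "cross_disjoint \<S> \<T>" by (auto simp: cross_disjoint_def)
    moreover have "\<S> \<subseteq> \<F>" "\<T> \<subseteq> \<F>" using S(1) T(1) by (auto simp: \<A>_def)
    ultimately show False using free[of \<S> \<T>] S(2) T(2) by blast
  qed
qed

end

text \<open>The \<open>(k - 1)\<close>-sets that meet a fixed \<open>m\<close>-set number about
  \<open>m\<close> times a binomial coefficient of order \<open>n^(k - 2)\<close>. Hence
  \<open>m - 1\<close> such coefficients plus any lower-order term fall short.\<close>

lemma core_growth:
  fixes K k m :: nat
  assumes "3 \<le> k" "3 \<le> m"
  shows "\<exists>n0. \<forall>n\<ge>n0. (m - 1) * ((n - 2) choose (k - 2)) + K * ((n - 3) choose (k - 3))
           + ((n - 1 - m) choose (k - 1)) < ((n - 1) choose (k - 1))"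
proof -
  have kk: "k - 3 + 1 = k - 2" "k - 2 + 1 = k - 1" using assms(1) by auto
  obtain n0 where n0: "\<forall>n\<ge>n0. ((m - 1) * (m - 1) + K) * (n choose (k - 3)) < ((n - (m - 2)) choose (k - 2))"
    using binomial_dominates[of "(m - 1) * (m - 1) + K" "k - 3" "m - 2"] unfolding kk by blast
  show ?thesis
  proof (intro exI[of _ "n0 + 3 + m"] allI impI)
    fix n assume n: "n0 + 3 + m \<le> n"
    \<comment> \<open>Domination is used at \<open>n - 3\<close>, where the shift by
      \<open>m - 2\<close> produces exactly \<open>n - 1 - m\<close>.\<close>
    have n': "n0 \<le> n - 3" using n by linarith
    define p q where "p = ((n - 1 - m) choose (k - 2))" and "q = ((n - 3) choose (k - 3))"
    have "((n - 1 - m) choose (k - 1)) + m * p \<le> ((n - 1) choose (k - 1))"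
      using binomial_diff_ge[of m "n - 1" "k - 2"] n unfolding kk p_def by simp
    moreover have "n - 2 - (m - 1) = n - 1 - m" "n - 2 - 1 = n - 3"
      "n - 3 - (m - 2) = n - 1 - m" using n assms(2) by auto
    then have "((n - 2) choose (k - 2)) \<le> p + (m - 1) * q" "((m - 1) * (m - 1) + K) * q < p"
      using binomial_diff_le[of "n - 2" "k - 3" "m - 1"] n0[rule_format, OF n'] n
      unfolding kk p_def q_def by simp_all
    then have "(m - 1) * ((n - 2) choose (k - 2)) + K * q < (m - 1) * p + p"
      using mult_le_mono2[of "(n - 2) choose (k - 2)" "p + (m - 1) * q" "m - 1"]
      by (simp add: algebra_simps)
    moreover have "(m - 1) * p + p = m * p" using assms(2) by (cases m) auto
    ultimately show "(m - 1) * ((n - 2) choose (k - 2)) + K * ((n - 3) choose (k - 3))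
           + ((n - 1 - m) choose (k - 1)) < ((n - 1) choose (k - 1))"
      unfolding q_def by linarith
  qed
qed

text \<open>Here \<open>x\<close> stands for the centre \<open>r\<close> and \<open>Y\<close> for
  the set \<open>T_set\<close>, without an enumeration of the \<open>A i\<close>. Only a lower bound
  on degrees in \<open>Y\<close> is recorded; that no other element reaches \<open>b + 1\<close> is
  recovered by counting.\<close>

definition star_extremal ::
  "'a set \<Rightarrow> nat \<Rightarrow> nat \<Rightarrow> nat \<Rightarrow> nat \<Rightarrow> nat \<Rightarrow> 'a set set \<Rightarrow> 'a \<Rightarrow> 'a set \<Rightarrow> bool" where
  "star_extremal V k s t b m \<F> x Y \<longleftrightarrow>
     x \<in> V \<and> Y \<subseteq> V - {x} \<and> card Y = m \<and> card {A \<in> \<F>. x \<notin> A} = s + b \<and>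
     (\<forall>y\<in>Y. b + 1 \<le> card {A \<in> {A \<in> \<F>. x \<notin> A}. y \<in> A}) \<and>
     {B \<in> nsets V k. x \<in> B \<and> B \<inter> Y \<noteq> {}} \<subseteq> \<F> \<and>
     card {G \<in> \<F>. x \<in> G \<and> G \<inter> Y = {}} = t - 1"

text \<open>The threshold is chosen before \<open>V\<close>, so the result applies to
  \<open>{1..n}\<close> with some elements removed. The hypothesis on \<open>\<R>\<close> is the
  form that the lower bound on \<open>ell\<close> takes there.\<close>

lemma bipartite_case:
  fixes k s t \<beta> L :: nat
  assumes "3 \<le> k" "1 \<le> s" "1 \<le> t"
  defines "m \<equiv> (s + \<beta>) * k div (\<beta> + 1)" and "b \<equiv> beta_hat k s \<beta>"
  shows "\<exists>n0. \<forall>(V :: 'a set) \<F>. biclique_free V \<F> k s t L \<and> n0 \<le> card V \<and>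
      (\<forall>\<R>\<subseteq>\<F>. (\<forall>A\<in>\<F> - \<R>. \<forall>B\<in>\<F> - \<R>. A \<inter> B \<noteq> {}) \<longrightarrow> s + \<beta> \<le> card \<R>) \<longrightarrow>
      card \<F> + ((card V - 1 - m) choose (k - 1)) < ((card V - 1) choose (k - 1)) + (s + b + t - 1) \<or>
      card \<F> + ((card V - 1 - m) choose (k - 1)) = ((card V - 1) choose (k - 1)) + (s + b + t - 1) \<and>
      (\<exists>x Y. star_extremal V k s t b m \<F> x Y)"
proof -
  \<comment> \<open>\<open>K\<close> collects the lower-order constants of
    \<open>star_card_le\<close> and \<open>triangle_card_le\<close>; bounded terms are absorbed
    because \<open>?q\<close> is at least 1.\<close>
  define K where "K = k * s * L + L ^ 3 + t + 3 * s"
  have km: "k \<le> m" unfolding m_def using quotient_eq[OF assms(2), of \<beta> k] by simp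
  then obtain n0 where n0: "\<forall>n\<ge>n0. (m - 1) * ((n - 2) choose (k - 2)) + K * ((n - 3) choose (k - 3))
           + ((n - 1 - m) choose (k - 1)) < ((n - 1) choose (k - 1))"
    using core_growth[OF assms(1), of m K] assms(1) by auto
  show ?thesis
  proof (intro exI[of _ "n0 + k"] allI impI, elim conjE)
    fix V :: "'a set" and \<F>
    assume "biclique_free V \<F> k s t L" and n: "n0 + k \<le> card V"
      and ell: "\<forall>\<R>\<subseteq>\<F>. (\<forall>A\<in>\<F> - \<R>. \<forall>B\<in>\<F> - \<R>. A \<inter> B \<noteq> {}) \<longrightarrow> s + \<beta> \<le> card \<R>"
    then interpret biclique_free V \<F> k s t L by simp
    let ?p = "(card V - 2) choose (k - 2)" and ?q = "(card V - 3) choose (k - 3)"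
    let ?h = "(card V - 1 - m) choose (k - 1)" and ?g = "(card V - 1) choose (k - 1)"
    have q: "1 \<le> ?q" using n k by (simp add: Suc_leI zero_less_binomial_iff)
    have small: "card \<F> + ?h < ?g + (s + b + t - 1)" if "card \<F> \<le> (m - 1) * ?p + K * ?q"
      using n0[rule_format, of "card V"] n that by linarith
    have "V \<noteq> {}" using n k by auto
    then consider (star) x where "x \<in> V" "\<forall>C. finite C \<longrightarrow> card C \<le> 2 \<longrightarrow> full L \<F> C \<longrightarrow> x \<in> C"
      | (triangle) u v w where "u \<noteq> v" "u \<noteq> w" "v \<noteq> w" "full L \<F> {u, v}" "full L \<F> {u, w}" "full L \<F> {v, w}"
      using star_or_triangle by blast
    then show "card \<F> + ?h < ?g + (s + b + t - 1) \<or> card \<F> + ?h = ?g + (s + b + t - 1) \<and>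
      (\<exists>x Y. star_extremal V k s t b m \<F> x Y)"
    proof cases
      case triangle
      \<comment> \<open>If \<open>m = 3\<close>, then \<open>k = 3\<close> and
        \<open>3 * (s - 1) \<le> \<beta>\<close>. But the triangle allows all disjoint pairs to be
        destroyed by removing at most \<open>3 * (s - 1)\<close> members, fewer than
        \<open>s + \<beta>\<close>.\<close>
      have "m \<noteq> 3"
      proof
        assume m3: "m = 3"
        then have "k = 3" "(s - 1) * k div (\<beta> + 1) = 0"
          using km k quotient_eq[OF s, of \<beta> k] by (auto simp: m_def)
        then have "(s - 1) * 3 < \<beta> + 1" by (simp add: div_eq_0_iff)
        moreover obtain \<R> where R: "\<R> \<subseteq> \<F>" "card \<R> \<le> 3 * (s - 1)"
            "\<forall>A\<in>\<F> - \<R>. \<forall>B\<in>\<F> - \<R>. A \<inter> B \<noteq> {}"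
          using triangle_card_le(2)[OF triangle] by blast
        then have "s + \<beta> \<le> 3 * (s - 1)" using ell[rule_format, OF R(1)] by simp
        ultimately show False using s by linarith
      qed
      then have "3 \<le> m - 1" using km k by simp
      then have "3 * ?p \<le> (m - 1) * ?p" by (rule mult_le_mono1)
      moreover have "3 * (s - 1) \<le> K * ?q"
      proof -
        have "3 * (s - 1) \<le> K * 1" by (simp add: K_def)
        also have "\<dots> \<le> K * ?q" using q by (rule mult_le_mono2)
        finally show ?thesis .
      qed
      ultimately have "card \<F> \<le> (m - 1) * ?p + K * ?q"
        using triangle_card_le(1)[OF triangle] by linarith
      then show ?thesis using small by blast
    next
      case star
      define \<A> where "\<A> = {A \<in> \<F>. x \<notin> A}"
      define Y where "Y = {y. y \<noteq> x \<and> full L \<F> {x, y}}"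
      \<comment> \<open>Once the members avoiding \<open>x\<close> are removed, all others share
        \<open>x\<close>.\<close>
      have a: "s + \<beta> \<le> card \<A>"
        using ell[rule_format, of \<A>] by (auto simp: \<A>_def)
      show ?thesis
      proof (cases "m \<le> card Y")
        case False
        have "card \<F> \<le> card Y * ?p + (k * s * L + L ^ 3) * ?q + t"
          unfolding Y_def by (rule star_card_le) (use star a in \<open>auto simp: \<A>_def\<close>)
        moreover have "card Y * ?p \<le> (m - 1) * ?p" using False by (intro mult_le_mono1) simp
        moreover have "t * 1 \<le> t * ?q" using q by (rule mult_le_mono2)
        moreover have "K * ?q = (k * s * L + L ^ 3) * ?q + t * ?q + 3 * s * ?q"
          by (simp add: K_def distrib_right)
        ultimately have "card \<F> \<le> (m - 1) * ?p + K * ?q" by linarith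
        then show ?thesis using small by blast
      next
        case True
        note str = star_structure[where x = x and \<beta> = \<beta>, folded \<A>_def Y_def m_def b_def, OF a True]
        define H where "H = {B \<in> nsets V k. x \<in> B \<and> B \<inter> Y \<noteq> {}}"
        define \<G> where "\<G> = {G \<in> \<F>. x \<in> G \<and> G \<inter> Y = {}}"
        have finH: "finite H" using finite_imp_finite_nsets[OF finV] by (simp add: H_def)
        have cH: "card H + ?h = ?g"
          using card_nsets_through_hitting[OF finV star(1) str(1), of k] k str(2) by (simp add: H_def)
        have un: "\<F> = \<A> \<union> (\<G> \<union> (H \<inter> \<F>))" using F by (auto simp: \<A>_def \<G>_def H_def)
        have "card \<F> = card \<A> + (card \<G> + card (H \<inter> \<F>))"
        proof -
          have "card \<F> = card (\<A> \<union> (\<G> \<union> (H \<inter> \<F>)))" using un by simp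
          also have "\<dots> = card \<A> + card (\<G> \<union> (H \<inter> \<F>))"
            using finF by (intro card_Un_disjoint) (auto simp: \<A>_def \<G>_def H_def)
          also have "card (\<G> \<union> (H \<inter> \<F>)) = card \<G> + card (H \<inter> \<F>)"
            using finF by (intro card_Un_disjoint) (auto simp: \<G>_def H_def)
          finally show ?thesis .
        qed
        moreover have "card (H \<inter> \<F>) \<le> card H" using finH by (simp add: card_mono)
        moreover have "card \<A> \<le> s + b" using str(3) .
        moreover have "card \<G> \<le> t - 1" using str(5) by (simp add: \<G>_def)
        moreover have "s + b + t - 1 = s + b + (t - 1)" using t by simp
        \<comment> \<open>The three pieces have separate upper bounds, so equality of the total
          forces equality in each.\<close>
        ultimately consider "card \<F> + ?h < ?g + (s + b + t - 1)"
          | "card \<F> + ?h = ?g + (s + b + t - 1)" "card \<A> = s + b" "card \<G> = t - 1"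
            "card (H \<inter> \<F>) = card H"
          using cH by linarith
        then show ?thesis
        proof cases
          case 2
          have "H \<inter> \<F> = H" using 2(4) finH by (simp add: card_subset_eq)
          then have "H \<subseteq> \<F>" by blast
          moreover have "\<forall>y\<in>Y. b + 1 \<le> card {A \<in> \<A>. y \<in> A}" using str(4) 2(2) by simp
          ultimately have "star_extremal V k s t b m \<F> x Y"
            using star(1) str(1,2) 2(2,3)
            by (simp add: star_extremal_def flip: \<A>_def \<G>_def H_def)
          then show ?thesis using 2(1) by blast
        qed simp
      qed
    qed
  qed
qed

subsection \<open>Complete multipartite subgraphs and matchings\<close>

text \<open>Numbering each \<open>P i\<close> sends the vertex \<open>(i, j)\<close> to a member.
  The subgraph takes only edges between different parts, since members of one \<open>P i\<close> may
  also be disjoint.\<close>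

lemma contains_complete_multipartiteI:
  assumes F: "\<F> \<subseteq> nsets {1..n} k" and k: "1 \<le> k"
    and P: "\<And>i. i \<in> {1..q} \<Longrightarrow> P i \<subseteq> \<F> \<and> finite (P i) \<and> card (P i) = s i"
    and disj: "\<And>i j. i \<in> {1..q} \<Longrightarrow> j \<in> {1..q} \<Longrightarrow> i \<noteq> j \<Longrightarrow> cross_disjoint (P i) (P j)"
  shows "contains_subgraph (with_proj (kneser_graph n k) \<restriction> \<F>) (with_proj (complete_multipartite q s))"
proof -
  have "\<exists>f. bij_betw f {1..s i} (P i)" if "i \<in> {1..q}" for i
    using ex_bij_betw_nat_finite_1[of "P i"] P[OF that] by auto
  then obtain f where f: "bij_betw (f i) {1..s i} (P i)" if "i \<in> {1..q}" for i by metis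
  define V where "V = (SIGMA i:{1..q}. {1..s i})"
  define E where "E = {(x, y) \<in> V \<times> V. fst x \<noteq> fst y}"
  define g where "g = (\<lambda>x. f (fst x) (snd x))"
  have K: "with_proj (complete_multipartite q s) = \<lparr>verts = V, arcs = E, tail = fst, head = snd\<rparr>"
    by (simp add: complete_multipartite_def Let_def V_def E_def with_proj_def)
  have fstV: "fst x \<in> {1..q}" "snd x \<in> {1..s (fst x)}" if "x \<in> V" for x
    using that by (auto simp: V_def)
  then have gP: "g x \<in> P (fst x)" "fst x \<in> {1..q}" if "x \<in> V" for x
    using that f[of "fst x"] by (simp_all add: g_def bij_betwE)
  have gF: "g x \<in> \<F>" if "x \<in> V" for x using gP[OF that] P by blast
  \<comment> \<open>Disjoint images are distinct only because they are nonempty; this is where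
    \<open>k \<ge> 1\<close> enters.\<close>
  have ne: "g x \<noteq> {}" if "x \<in> V" for x using gF[OF that] F k by (auto simp: nsets_def)
  have gdisj: "g x \<inter> g y = {}" if "x \<in> V" "y \<in> V" "fst x \<noteq> fst y" for x y
    using disj[OF gP(2)[OF that(1)] gP(2)[OF that(2)] that(3)] gP(1)[OF that(1)] gP(1)[OF that(2)]
    by (simp add: cross_disjoint_def)
  have inj: "inj_on g V"
  proof (rule inj_onI)
    fix x y assume xy: "x \<in> V" "y \<in> V" "g x = g y"
    then have fst: "fst x = fst y" using gdisj[OF xy(1,2)] ne[OF xy(1)] by auto
    moreover have "snd x \<in> {1..s (fst x)}" "snd y \<in> {1..s (fst x)}"
      using xy(1,2) fst by (auto simp: V_def)
    ultimately have "snd x = snd y"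
      using f[OF gP(2)[OF xy(1)]] xy(3) by (auto simp: g_def bij_betw_def dest: inj_onD)
    then show "x = y" using fst by (simp add: prod_eq_iff)
  qed
  define H where "H = \<lparr>verts = g ` V, arcs = map_prod g g ` E, tail = fst, head = snd\<rparr>"
  \<comment> \<open>\<open>digraph_iso\<close> runs from the subgraph to the multipartite graph, so
    its maps come from the inverse of \<open>g\<close>.\<close>
  define h where "h = inv_into V g"
  have h: "h (g x) = x" if "x \<in> V" for x using inj that by (simp add: h_def)
  have EV: "x \<in> V" "y \<in> V" "fst x \<noteq> fst y" if "(x, y) \<in> E" for x y using that by (auto simp: E_def)
  have wfH: "wf_digraph H"
    by unfold_locales (auto simp: H_def dest: EV)
  have "subgraph H (with_proj (kneser_graph n k) \<restriction> \<F>)"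
    unfolding subgraph_def
  proof (intro conjI wfH)
    show "verts H \<subseteq> verts (with_proj (kneser_graph n k) \<restriction> \<F>)"
      using gF by (auto simp: H_def)
    have "(g x, g y) \<in> arcs (with_proj (kneser_graph n k) \<restriction> \<F>)" if "(x, y) \<in> E" for x y
      using gF[OF EV(1)[OF that]] gF[OF EV(2)[OF that]] gdisj[OF EV[OF that]] F
      by (auto simp: kneser_graph_def)
    then show "arcs H \<subseteq> arcs (with_proj (kneser_graph n k) \<restriction> \<F>)"
      by (auto simp: H_def)
    show "wf_digraph (with_proj (kneser_graph n k) \<restriction> \<F>)"
      by unfold_locales auto
    show "compatible (with_proj (kneser_graph n k) \<restriction> \<F>) H"
      by (simp add: compatible_def H_def)
  qed
  moreover have "digraph_iso H (with_proj (complete_multipartite q s))"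
    unfolding digraph_iso_def
  proof (intro exI conjI)
    show "pre_digraph.digraph_isomorphism H \<lparr>iso_verts = h, iso_arcs = map_prod h h, iso_head = snd, iso_tail = fst\<rparr>"
      unfolding pre_digraph.digraph_isomorphism_def
    proof (intro conjI wfH)
      show "inj_on (iso_verts \<lparr>iso_verts = h, iso_arcs = map_prod h h, iso_head = snd, iso_tail = fst\<rparr>) (verts H)"
        by (auto simp: H_def inj_on_def h)
      show "inj_on (iso_arcs \<lparr>iso_verts = h, iso_arcs = map_prod h h, iso_head = snd, iso_tail = fst\<rparr>) (arcs H)"
      proof -
        have "inj_on h (g ` V)" by (auto simp: inj_on_def h)
        then have "inj_on (map_prod h h) (g ` V \<times> g ` V)" by (intro map_prod_inj_on)
        moreover have "arcs H \<subseteq> g ` V \<times> g ` V" by (auto simp: H_def dest: EV)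
        ultimately show ?thesis by (simp add: inj_on_subset)
      qed
    qed (auto simp: H_def)
    have hE: "map_prod h h (map_prod g g e) = e" if "e \<in> E" for e
    proof -
      obtain x y where "e = (x, y)" by (cases e)
      then show ?thesis using h[OF EV(1)] h[OF EV(2)] that by simp
    qed
    have "h ` g ` V = V" by (auto simp: h image_image)
    moreover have "map_prod h h ` map_prod g g ` E = E"
      by (simp add: image_image hE cong: image_cong_simp)
    ultimately show "with_proj (complete_multipartite q s)
        = app_iso \<lparr>iso_verts = h, iso_arcs = map_prod h h, iso_head = snd, iso_tail = fst\<rparr> H"
      unfolding K app_iso_def by (simp add: H_def)
  qed
  ultimately show ?thesis unfolding contains_subgraph_def by blast
qed

text \<open>Among pairwise disjoint sets at most \<open>card X\<close> can meet \<open>X\<close>. So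
  \<open>card X + 2\<close> of them include two that avoid \<open>X\<close>, contradicting
  \<open>int\<close>.\<close>

lemma ell_le:
  fixes X :: "'a set"
  assumes "finite X" "card X + 2 = p" "\<R> \<subseteq> \<F>" "finite \<R>"
    and int: "\<And>A B. A \<in> \<F> - \<R> \<Longrightarrow> B \<in> \<F> - \<R> \<Longrightarrow> A \<inter> X = {} \<Longrightarrow> B \<inter> X = {} \<Longrightarrow> A \<inter> B \<noteq> {}"
  shows "ell p \<F> \<le> card \<R>"
proof -
  have "\<not> (\<exists>\<P>\<subseteq>\<F> - \<R>. card \<P> = p \<and> pairwise disjnt \<P>)"
  proof
    assume "\<exists>\<P>\<subseteq>\<F> - \<R>. card \<P> = p \<and> pairwise disjnt \<P>"
    then obtain \<P> where P: "\<P> \<subseteq> \<F> - \<R>" "card \<P> = p" "pairwise disjnt \<P>" by blast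
    have finP: "finite \<P>" using P(2) assms(2) by (simp add: card_ge_0_finite)
    define \<H> where "\<H> = {A \<in> \<P>. A \<inter> X \<noteq> {}}"
    define e where "e = (\<lambda>A. SOME z. z \<in> A \<inter> X)"
    have e: "e A \<in> A \<inter> X" if "A \<in> \<H>" for A
    proof -
      have "\<exists>z. z \<in> A \<inter> X" using that by (auto simp: \<H>_def)
      then show ?thesis unfolding e_def by (rule someI_ex)
    qed
    have "inj_on e \<H>"
    proof (rule inj_onI)
      fix A B assume AB: "A \<in> \<H>" "B \<in> \<H>" "e A = e B"
      then have "\<not> disjnt A B" using e[OF AB(1)] e[OF AB(2)] by (auto simp: disjnt_def)
      then show "A = B" using P(3) AB(1,2) unfolding pairwise_def \<H>_def by blast
    qed
    then have "card \<H> \<le> card X" using e assms(1) by (intro card_inj_on_le[of e]) auto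
    then have "2 \<le> card (\<P> - \<H>)"
      using P(2) assms(2) finP card_Diff_subset[of \<H> \<P>] by (simp add: \<H>_def)
    then obtain \<D> where "\<D> \<subseteq> \<P> - \<H>" "card \<D> = 2" by (meson obtain_subset_with_card_n)
    then obtain A B where AB: "A \<in> \<P> - \<H>" "B \<in> \<P> - \<H>" "A \<noteq> B" by (auto simp: card_2_iff)
    then have "A \<inter> B = {}" using P(3) by (auto simp: pairwise_def disjnt_def)
    moreover have "A \<inter> B \<noteq> {}" using AB P(1) by (intro int) (auto simp: \<H>_def)
    ultimately show False by simp
  qed
  then show ?thesis unfolding ell_def using assms(3,4) by (intro Least_le) blast
qed

subsection \<open>Reduction to the bipartite case\<close>

text \<open>The analogue of \<open>core_growth\<close> one order higher: \<open>r - 2\<close> stars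
  and a lower-order term are smaller than the family of \<open>k\<close>-sets meeting
  \<open>r - 1\<close> points.\<close>

lemma reduction_growth:
  fixes K k r :: nat
  assumes "2 \<le> k" "2 \<le> r"
  shows "\<exists>n0. \<forall>n\<ge>n0. (r - 2) * ((n - 1) choose (k - 1)) + K * ((n - 2) choose (k - 2))
           + ((n - (r - 1)) choose k) < (n choose k)"
proof -
  have kk: "k - 2 + 1 = k - 1" "k - 1 + 1 = k" using assms(1) by auto
  obtain n0 where n0: "\<forall>n\<ge>n0. ((r - 2) * (r - 2) + K) * (n choose (k - 2)) < ((n - (r - 1)) choose (k - 1))"
    using binomial_dominates[of "(r - 2) * (r - 2) + K" "k - 2" "r - 1"] unfolding kk by blast
  show ?thesis
  proof (intro exI[of _ "n0 + 2 + r"] allI impI)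
    fix n assume n: "n0 + 2 + r \<le> n"
    have n': "n0 \<le> n - 2" using n by linarith
    define p q where "p = ((n - (r - 1)) choose (k - 1))" and "q = ((n - 2) choose (k - 2))"
    have "((n - (r - 1)) choose k) + (r - 1) * p \<le> (n choose k)"
      using binomial_diff_ge[of "r - 1" n "k - 1"] n unfolding kk p_def by simp
    moreover have "((r - 2) * (r - 2) + K) * q < p"
    proof -
      have "((n - 2 - (r - 1)) choose (k - 1)) \<le> p"
        unfolding p_def by (intro binomial_right_mono) simp
      then show ?thesis using n0[rule_format, OF n'] unfolding q_def by linarith
    qed
    moreover have "((n - 1) choose (k - 1)) \<le> p + (r - 2) * q"
    proof -
      have "n - 1 - (r - 2) = n - (r - 1)" "n - 1 - 1 = n - 2" using n assms(2) by auto
      then show ?thesis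
        using binomial_diff_le[of "n - 1" "k - 2" "r - 2"] unfolding kk p_def q_def by simp
    qed
    then have "(r - 2) * ((n - 1) choose (k - 1)) \<le> (r - 2) * p + (r - 2) * (r - 2) * q"
      using mult_le_mono2[of "(n - 1) choose (k - 1)" "p + (r - 2) * q" "r - 2"]
      by (simp add: distrib_left mult.assoc)
    moreover have "((r - 2) * (r - 2) + K) * q = (r - 2) * (r - 2) * q + K * q"
      by (simp add: distrib_right)
    moreover have "(r - 1) * p = (r - 2) * p + p"
    proof -
      have "r - 1 = Suc (r - 2)" using assms(2) by simp
      then show ?thesis by simp
    qed
    ultimately show "(r - 2) * ((n - 1) choose (k - 1)) + K * ((n - 2) choose (k - 2))
           + ((n - (r - 1)) choose k) < (n choose k)"
      unfolding q_def[symmetric] by linarith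
  qed
qed

text \<open>\<open>X\<close> becomes \<open>[r - 1]\<close> after relabelling. The absence of
  cross-disjoint pairs is recorded because the union-intersecting property is derived from
  it.\<close>

definition multi_star_extremal ::
  "nat \<Rightarrow> nat \<Rightarrow> nat \<Rightarrow> nat \<Rightarrow> nat \<Rightarrow> nat \<Rightarrow> nat \<Rightarrow> nat set set \<Rightarrow> nat set \<Rightarrow> nat \<Rightarrow> nat set \<Rightarrow> bool" where
  "multi_star_extremal n k r s t b m \<F> X x Y \<longleftrightarrow>
     X \<subseteq> {1..n} \<and> card X = r - 1 \<and> {B \<in> nsets {1..n} k. B \<inter> X \<noteq> {}} \<subseteq> \<F> \<and>
     star_extremal ({1..n} - X) k s t b m {A \<in> \<F>. A \<inter> X = {}} x Y \<and>
     (\<forall>\<S> \<T>. \<S> \<subseteq> {A \<in> \<F>. A \<inter> X = {}} \<longrightarrow> \<T> \<subseteq> {A \<in> \<F>. A \<inter> X = {}} \<longrightarrow>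
        card \<S> = s \<longrightarrow> card \<T> = t \<longrightarrow> \<not> cross_disjoint \<S> \<T>)"

text \<open>With \<open>r - 1\<close> full singletons, the members avoiding them fall under
  \<open>bipartite_case\<close>, and the others are at most all \<open>k\<close>-sets meeting
  \<open>X\<close>. With fewer, the family is too small by order \<open>n^(k - 1)\<close>.\<close>

lemma extremal_structure:
  fixes k r \<beta> :: nat and s :: "nat \<Rightarrow> nat"
  assumes k: "3 \<le> k" and r: "1 \<le> r" and s: "1 \<le> s (r + 1)" and t: "1 \<le> s r"
  defines "m \<equiv> (s (r + 1) + \<beta>) * k div (\<beta> + 1)" and "b \<equiv> beta_hat k (s (r + 1)) \<beta>"
  shows "\<exists>n0. \<forall>n\<ge>n0. \<forall>\<F>. \<F> \<subseteq> nsets {1..n} k \<and>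
      \<not> contains_subgraph (with_proj (kneser_graph n k) \<restriction> \<F>) (with_proj (complete_multipartite (r + 1) s)) \<and>
      s (r + 1) + \<beta> \<le> ell (r + 1) \<F> \<longrightarrow>
      card \<F> + ((n - (r - 1)) choose k) + ((n - r - m) choose (k - 1))
        < (n choose k) + ((n - r) choose (k - 1)) + (s (r + 1) + b + s r - 1) \<or>
      card \<F> + ((n - (r - 1)) choose k) + ((n - r - m) choose (k - 1))
        = (n choose k) + ((n - r) choose (k - 1)) + (s (r + 1) + b + s r - 1) \<and>
      (\<exists>X x Y. multi_star_extremal n k r (s (r + 1)) (s r) b m \<F> X x Y)"
proof -
  \<comment> \<open>This lets \<open>full_greedy\<close> build all \<open>r + 1\<close> parts and
    covers the demand of \<open>biclique_free\<close>.\<close>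
  define L where "L = k * (\<Sum>i\<in>{1..r + 1}. s i + 1)"
  have sums: "(\<Sum>i\<in>{1..r + 1}. s i + 1) = (\<Sum>i\<in>{1..r - 1}. s i + 1) + (s r + 1) + (s (r + 1) + 1)"
  proof -
    have r': "r = Suc (r - 1)" using r by simp
    have "(\<Sum>i\<in>{1..r}. s i + 1) = (\<Sum>i\<in>{1..r - 1}. s i + 1) + (s r + 1)"
      by (subst r', subst sum.cl_ivl_Suc) (use r in auto)
    then show ?thesis by simp
  qed
  obtain n1 where n1: "\<forall>(V :: nat set) \<F>. biclique_free V \<F> k (s (r + 1)) (s r) L \<and> n1 \<le> card V \<and>
      (\<forall>\<R>\<subseteq>\<F>. (\<forall>A\<in>\<F> - \<R>. \<forall>B\<in>\<F> - \<R>. A \<inter> B \<noteq> {}) \<longrightarrow> s (r + 1) + \<beta> \<le> card \<R>) \<longrightarrow>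
      card \<F> + ((card V - 1 - m) choose (k - 1)) < ((card V - 1) choose (k - 1)) + (s (r + 1) + b + s r - 1) \<or>
      card \<F> + ((card V - 1 - m) choose (k - 1)) = ((card V - 1) choose (k - 1)) + (s (r + 1) + b + s r - 1) \<and>
      (\<exists>x Y. star_extremal V k (s (r + 1)) (s r) b m \<F> x Y)"
    using bipartite_case[where ?'a = nat and \<beta> = \<beta> and L = L, OF k s t, folded m_def b_def] ..
  \<comment> \<open>The guard matters: for \<open>r = 1\<close> the inequality is false, but then
    \<open>r - 1 \<le> card \<Phi>\<close> always holds.\<close>
  obtain n2 where n2: "\<forall>n\<ge>n2. 2 \<le> r \<longrightarrow> (r - 2) * ((n - 1) choose (k - 1))
           + L ^ 2 * ((n - 2) choose (k - 2)) + ((n - (r - 1)) choose k) < (n choose k)"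
  proof (cases "2 \<le> r")
    case True
    then show ?thesis using reduction_growth[of k r "L ^ 2"] k that by auto
  next
    case False
    then show ?thesis using that[of 0] by simp
  qed
  show ?thesis
  proof (intro exI[of _ "n1 + n2 + r"] allI impI, elim conjE)
    fix n \<F>
    assume n: "n1 + n2 + r \<le> n" and F: "\<F> \<subseteq> nsets {1..n} k"
      and free: "\<not> contains_subgraph (with_proj (kneser_graph n k) \<restriction> \<F>) (with_proj (complete_multipartite (r + 1) s))"
      and ell: "s (r + 1) + \<beta> \<le> ell (r + 1) \<F>"
    have mem: "finite A \<and> card A = k" if "A \<in> \<F>" for A using F that by (auto simp: nsets_def)
    have finF: "finite \<F>" using F finite_imp_finite_nsets finite_subset by blast
    have no_parts: False
      if "\<And>i. i \<in> {1..r + 1} \<Longrightarrow> P i \<subseteq> \<F> \<and> finite (P i) \<and> card (P i) = s i"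
        "\<And>i j. i \<in> {1..r + 1} \<Longrightarrow> j \<in> {1..r + 1} \<Longrightarrow> i \<noteq> j \<Longrightarrow> cross_disjoint (P i) (P j)" for P
      using contains_complete_multipartiteI[of \<F> n k "r + 1" P s] F k that free by auto
    \<comment> \<open>The empty set is disjoint from itself, so if it were full,
      \<open>r + 1\<close> copies of it would extend to the forbidden configuration.\<close>
    have not_full_empty: "\<not> full L \<F> {}"
    proof
      assume "full L \<F> {}"
      then have "\<exists>P. \<forall>i\<in>{1..r + 1}. P i \<subseteq> \<F> \<and> finite (P i) \<and> card (P i) = s i \<and>
          cross_disjoint (P i) {{}} \<and> (\<forall>A\<in>P i. {} \<subseteq> A) \<and>
          (\<forall>j\<in>{1..r + 1}. i \<noteq> j \<longrightarrow> cross_disjoint (P i) (P j))"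
        using k by (intro full_greedy[OF mem, where L = L]) (auto simp: L_def)
      then obtain P where P: "\<forall>i\<in>{1..r + 1}. P i \<subseteq> \<F> \<and> finite (P i) \<and> card (P i) = s i \<and>
          cross_disjoint (P i) {{}} \<and> (\<forall>A\<in>P i. {} \<subseteq> A) \<and>
          (\<forall>j\<in>{1..r + 1}. i \<noteq> j \<longrightarrow> cross_disjoint (P i) (P j))" by blast
      show False by (rule no_parts[of P]) (use P in blast)+
    qed
    define \<Phi> where "\<Phi> = {x \<in> {1..n}. full L \<F> {x}}"
    have fin\<Phi>: "finite \<Phi>" by (simp add: \<Phi>_def)
    let ?M = "card \<F> + ((n - (r - 1)) choose k) + ((n - r - m) choose (k - 1))"
    let ?N = "(n choose k) + ((n - r) choose (k - 1)) + (s (r + 1) + b + s r - 1)"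
    show "?M < ?N \<or> ?M = ?N \<and>
      (\<exists>X x Y. multi_star_extremal n k r (s (r + 1)) (s r) b m \<F> X x Y)"
    proof (cases "r - 1 \<le> card \<Phi>")
      case False
      then have r2: "2 \<le> r" and c\<Phi>: "card \<Phi> \<le> r - 2" by auto
      have "card (\<Union>x\<in>\<Phi>. {A \<in> \<F>. {x} \<subseteq> A}) \<le> (\<Sum>x\<in>\<Phi>. card {A \<in> \<F>. {x} \<subseteq> A})"
        by (rule card_UN_le[OF fin\<Phi>])
      also have "\<dots> \<le> (\<Sum>x\<in>\<Phi>. (n - 1) choose (k - 1))"
      proof (rule sum_mono)
        fix x
        show "card {A \<in> \<F>. {x} \<subseteq> A} \<le> (n - 1) choose (k - 1)"
          using card_nsets_superset_le[OF _ F, of "{x}"] k by simp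
      qed
      also have "\<dots> \<le> (r - 2) * ((n - 1) choose (k - 1))" using c\<Phi> by (simp add: mult_le_mono1)
      finally have 1: "card (\<Union>x\<in>\<Phi>. {A \<in> \<F>. {x} \<subseteq> A}) \<le> (r - 2) * ((n - 1) choose (k - 1))" .
      let ?Q = "{A \<in> \<F>. {} \<subseteq> A \<and> (\<forall>D\<subseteq>A. card D < 2 \<longrightarrow> \<not> full L \<F> D)}"
      have 2: "card ?Q \<le> L ^ 2 * ((n - 2) choose (k - 2))"
        using card_without_full_le[OF _ F, of "{}" 2 L] k by simp
      have "\<F> \<subseteq> (\<Union>x\<in>\<Phi>. {A \<in> \<F>. {x} \<subseteq> A}) \<union> ?Q"
      proof
        fix A assume A: "A \<in> \<F>"
        show "A \<in> (\<Union>x\<in>\<Phi>. {A \<in> \<F>. {x} \<subseteq> A}) \<union> ?Q"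
        proof (rule ccontr)
          assume "A \<notin> (\<Union>x\<in>\<Phi>. {A \<in> \<F>. {x} \<subseteq> A}) \<union> ?Q"
          then obtain D where D: "D \<subseteq> A" "card D < 2" "full L \<F> D" and A': "\<forall>x\<in>\<Phi>. x \<notin> A"
            using A by auto
          \<comment> \<open>\<open>card D < 2\<close> also admits the empty set and infinite sets,
            whose \<open>card\<close> is 0; both are excluded to reach a singleton.\<close>
          have "finite D" using D(1) mem[OF A] finite_subset by blast
          moreover have "D \<noteq> {}" using D(3) not_full_empty by auto
          ultimately have "card D = 1" using D(2) by (metis card_gt_0_iff less_2_cases not_gr_zero One_nat_def)
          then obtain x where "D = {x}" by (auto simp: card_1_singleton_iff)
          moreover have "A \<subseteq> {1..n}" using A F by (auto simp: nsets_def)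
          ultimately have "x \<in> \<Phi>" "x \<in> A" using D by (auto simp: \<Phi>_def)
          then show False using A' by blast
        qed
      qed
      then have "card \<F> \<le> card ((\<Union>x\<in>\<Phi>. {A \<in> \<F>. {x} \<subseteq> A}) \<union> ?Q)"
        using finF fin\<Phi> by (intro card_mono) auto
      then have cF: "card \<F> \<le> (r - 2) * ((n - 1) choose (k - 1)) + L ^ 2 * ((n - 2) choose (k - 2))"
        using card_Un_le[of "\<Union>x\<in>\<Phi>. {A \<in> \<F>. {x} \<subseteq> A}" ?Q] add_mono[OF 1 2] by (meson le_trans)
      have "(r - 2) * ((n - 1) choose (k - 1))
           + L ^ 2 * ((n - 2) choose (k - 2)) + ((n - (r - 1)) choose k) < (n choose k)"
        using n2[rule_format, of n] n r2 by simp
      then have "card \<F> + ((n - (r - 1)) choose k) < (n choose k)"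
        by (rule le_less_trans[OF add_right_mono[OF cF]])
      moreover have "((n - r - m) choose (k - 1)) \<le> ((n - r) choose (k - 1))"
        by (intro binomial_right_mono) simp
      ultimately have "?M < (n choose k) + ((n - r) choose (k - 1))"
        by (rule add_less_le_mono)
      then have "?M < ?N" by (rule trans_less_add1)
      then show ?thesis ..
    next
      case True
      obtain X where X: "X \<subseteq> \<Phi>" "card X = r - 1" "finite X"
        by (rule obtain_subset_with_card_n[OF True])
      have Xn: "X \<subseteq> {1..n}" using X(1) by (auto simp: \<Phi>_def)
      define V where "V = {1..n} - X"
      define \<G> where "\<G> = {A \<in> \<F>. A \<inter> X = {}}"
      have cV: "card V = n - (r - 1)" using X Xn by (simp add: V_def card_Diff_subset)
      \<comment> \<open>The full singletons of \<open>X\<close> supply the missing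
        \<open>r - 1\<close> parts: extended away from a cross-disjoint pair, they complete the
        forbidden multipartite graph.\<close>
      have free2: "\<not> cross_disjoint \<S> \<T>"
        if "\<S> \<subseteq> \<G>" "\<T> \<subseteq> \<G>" "card \<S> = s (r + 1)" "card \<T> = s r" for \<S> \<T>
      proof
        assume cd: "cross_disjoint \<S> \<T>"
        have fin: "finite \<S>" "finite \<T>" using that finF by (auto simp: \<G>_def intro: finite_subset)
        obtain e where e: "bij_betw e {1..r - 1} X"
          using ex_bij_betw_nat_finite_1[OF X(3)] X(2) by auto
        define W where "W = \<Union>\<S> \<union> \<Union>\<T>"
        have ST: "\<S> \<subseteq> \<F>" "\<T> \<subseteq> \<F>" using that by (auto simp: \<G>_def)
        have finW: "finite W" unfolding W_def using fin ST mem by (intro finite_UnI finite_Union) blast+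
        have "card (\<Union>\<S>) \<le> k * s (r + 1)"
          using card_Union_le[of \<S> k] fin(1) subsetD[OF ST(1)] mem that(3) by (metis order_refl)
        moreover have "card (\<Union>\<T>) \<le> k * s r"
          using card_Union_le[of \<T> k] fin(2) subsetD[OF ST(2)] mem that(4) by (metis order_refl)
        ultimately have "card W \<le> k * s (r + 1) + k * s r"
          unfolding W_def using card_Un_le[of "\<Union>\<S>" "\<Union>\<T>"] by linarith
        then have cW: "card W + k * (\<Sum>i\<in>{1..r - 1}. s i + 1) \<le> L"
          unfolding L_def sums by (simp add: distrib_left)
        have WX: "W \<inter> X = {}" using that by (auto simp: W_def \<G>_def)
        have "\<exists>P. \<forall>i\<in>{1..r - 1}. P i \<subseteq> \<F> \<and> finite (P i) \<and> card (P i) = s i \<and>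
          cross_disjoint (P i) {W} \<and> (\<forall>A\<in>P i. {e i} \<subseteq> A) \<and>
          (\<forall>j\<in>{1..r - 1}. i \<noteq> j \<longrightarrow> cross_disjoint (P i) (P j))"
        proof (rule full_greedy[OF mem _ _ finW cW])
          fix i assume i: "i \<in> {1..r - 1}"
          then have "e i \<in> X" using e by (rule bij_betwE[rule_format, rotated])
          then show "full L \<F> {e i} \<and> finite {e i} \<and> card {e i} < k \<and> W \<inter> {e i} = {}"
            using X(1) WX k by (auto simp: \<Phi>_def)
          fix j assume "j \<in> {1..r - 1}" "i \<noteq> j"
          then show "{e i} \<inter> {e j} = {}" using e i by (auto simp: bij_betw_def dest: inj_onD)
        qed
        then obtain P where P: "\<forall>i\<in>{1..r - 1}. P i \<subseteq> \<F> \<and> finite (P i) \<and> card (P i) = s i \<and>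
          cross_disjoint (P i) {W} \<and> (\<forall>A\<in>P i. {e i} \<subseteq> A) \<and>
          (\<forall>j\<in>{1..r - 1}. i \<noteq> j \<longrightarrow> cross_disjoint (P i) (P j))" by blast
        define P' where "P' = P(r := \<T>, r + 1 := \<S>)"
        have PW: "cross_disjoint (P i) \<S>" "cross_disjoint (P i) \<T>"
          "cross_disjoint \<S> (P i)" "cross_disjoint \<T> (P i)" if "i \<in> {1..r - 1}" for i
        proof -
          have "A \<inter> W = {}" if "A \<in> P i" for A
            using bspec[OF P \<open>i \<in> {1..r - 1}\<close>] that by (simp add: cross_disjoint_def)
          then show "cross_disjoint (P i) \<S>" "cross_disjoint (P i) \<T>"
            "cross_disjoint \<S> (P i)" "cross_disjoint \<T> (P i)"
            unfolding cross_disjoint_def W_def by blast+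
        qed
        have cases: "i \<in> {1..r - 1} \<and> i \<noteq> r \<and> i \<noteq> r + 1 \<or> i = r \<or> i = r + 1" if "i \<in> {1..r + 1}" for i
          using that by auto
        have cd': "cross_disjoint \<T> \<S>" using cd by (auto simp: cross_disjoint_def)
        show False
        proof (rule no_parts[of P'])
          fix i assume i: "i \<in> {1..r + 1}"
          show "P' i \<subseteq> \<F> \<and> finite (P' i) \<and> card (P' i) = s i"
            using cases[OF i] P fin that by (auto simp: P'_def \<G>_def)
          fix j assume j: "j \<in> {1..r + 1}" and ij: "i \<noteq> j"
          have "cross_disjoint (P i) (P j)" if "i \<in> {1..r - 1}" "j \<in> {1..r - 1}"
            using bspec[OF P that(1)] that(2) ij by blast
          then show "cross_disjoint (P' i) (P' j)"
            using cases[OF i] cases[OF j] ij PW[of i] PW[of j] cd cd' unfolding P'_def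
            by (elim disjE) simp_all
        qed
      qed
      have "biclique_free V \<G> k (s (r + 1)) (s r) L"
      proof
        show "\<G> \<subseteq> nsets V k" using F by (auto simp: \<G>_def V_def nsets_def)
        show "k * (s (r + 1) + s r + 1) \<le> L" unfolding L_def sums by (intro mult_le_mono2) simp
        show "finite V" by (simp add: V_def)
      qed (fact k s t free2)+
      moreover have "n1 \<le> card V" unfolding cV using n by simp
      \<comment> \<open>As \<open>X\<close> has \<open>r - 1\<close> elements, removing such an
        \<open>\<R>\<close> leaves no \<open>r + 1\<close> pairwise disjoint members of
        \<open>\<F>\<close>.\<close>
      moreover have "s (r + 1) + \<beta> \<le> card \<R>"
        if R: "\<R> \<subseteq> \<G>" "\<forall>A\<in>\<G> - \<R>. \<forall>B\<in>\<G> - \<R>. A \<inter> B \<noteq> {}" for \<R>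
      proof -
        have "ell (r + 1) \<F> \<le> card \<R>"
        proof (rule ell_le[OF X(3)])
          show "finite \<R>" using that(1) finF by (auto simp: \<G>_def intro: finite_subset)
          show "card X + 2 = r + 1" using X(2) r by simp
          show "\<R> \<subseteq> \<F>" using that(1) by (auto simp: \<G>_def)
          show "A \<inter> B \<noteq> {}" if "A \<in> \<F> - \<R>" "B \<in> \<F> - \<R>" "A \<inter> X = {}" "B \<inter> X = {}" for A B
          proof -
            have "A \<in> \<G> - \<R>" "B \<in> \<G> - \<R>" using that by (auto simp: \<G>_def)
            then show ?thesis using R(2) by blast
          qed
        qed
        then show ?thesis using ell by linarith
      qed
      moreover have "card V - 1 = n - r" using cV r by simp
      ultimately have dich: "card \<G> + ((n - r - m) choose (k - 1)) < ((n - r) choose (k - 1)) + (s (r + 1) + b + s r - 1) \<or>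
        card \<G> + ((n - r - m) choose (k - 1)) = ((n - r) choose (k - 1)) + (s (r + 1) + b + s r - 1) \<and>
        (\<exists>x Y. star_extremal V k (s (r + 1)) (s r) b m \<G> x Y)"
        using n1[rule_format, of V \<G>] by simp
      define H where "H = {B \<in> nsets {1..n} k. B \<inter> X \<noteq> {}}"
      have finH: "finite H" by (simp add: H_def finite_imp_finite_nsets)
      have cH: "card H + ((n - (r - 1)) choose k) = (n choose k)"
        using card_nsets_hitting[OF _ Xn, of k] X(2) by (simp add: H_def)
      have "\<F> = \<G> \<union> (H \<inter> \<F>)" using F by (auto simp: \<G>_def H_def)
      moreover have "card (\<G> \<union> (H \<inter> \<F>)) = card \<G> + card (H \<inter> \<F>)"
        using finF by (intro card_Un_disjoint) (auto simp: \<G>_def H_def)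
      ultimately have cF: "card \<F> = card \<G> + card (H \<inter> \<F>)" by simp
      have HF: "card (H \<inter> \<F>) \<le> card H" using finH by (simp add: card_mono)
      show ?thesis
      proof (cases "?M < ?N")
        case False
        \<comment> \<open>If \<open>?M\<close> is not below \<open>?N\<close>, the bounds on
          \<open>\<G>\<close> and on \<open>H \<inter> \<F>\<close> are both attained.\<close>
        then have eq: "card \<G> + ((n - r - m) choose (k - 1)) = ((n - r) choose (k - 1)) + (s (r + 1) + b + s r - 1)"
          "card (H \<inter> \<F>) = card H" using dich cF HF cH by linarith+
        then obtain x Y where "star_extremal V k (s (r + 1)) (s r) b m \<G> x Y" using dich by auto
        moreover have "H \<inter> \<F> = H" using eq(2) finH by (simp add: card_subset_eq)
        then have "H \<subseteq> \<F>" by blast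
        ultimately have "multi_star_extremal n k r (s (r + 1)) (s r) b m \<F> X x Y"
          unfolding multi_star_extremal_def V_def[symmetric] \<G>_def[symmetric] H_def[symmetric]
          using Xn X(2) free2 by blast
        moreover have "?M = ?N" using eq cF cH by linarith
        ultimately show ?thesis by blast
      qed simp
    qed
  qed
qed

subsection \<open>The extremal families\<close>

text \<open>Among \<open>s + b\<close> sets, missing at most \<open>s - 1\<close> means meeting at
  least \<open>b + 1\<close>. A single element of \<open>T\<close> achieves this, whereas all
  elements outside \<open>T\<close> together cannot, by
  \<open>card_meeting_outside_lt\<close>.\<close>

lemma star_part_eq:
  assumes A: "\<And>i. i \<in> {1..s + b} \<Longrightarrow> finite (A i) \<and> card (A i) = k" and s: "1 \<le> s"
    and T: "\<And>y. y \<in> T \<longleftrightarrow> b + 1 \<le> card {i \<in> {1..s + b}. y \<in> A i}"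
    and m: "(s + b) * k div (b + 1) = card T" and finT: "finite T"
  shows "star_part n k r (s + b) A s = {B \<in> star n k r. B \<inter> {1..r - 1} = {} \<and> B \<inter> T \<noteq> {}}"
proof -
  have less: "card {1..s + b} * k < (card T + 1) * (b + 1)"
    unfolding m[symmetric] using dividend_less_div_times[of "b + 1" "(s + b) * k"]
    by (simp add: algebra_simps)
  have deg: "b + 1 \<le> card {i \<in> {1..s + b}. y \<in> A i}" if "y \<in> T" for y using that T by simp
  have "card {i \<in> {1..s + b}. B \<inter> A i = {}} \<le> s - 1 \<longleftrightarrow> B \<inter> T \<noteq> {}" for B
  proof -
    have "card {1..s + b} = card ({i \<in> {1..s + b}. B \<inter> A i = {}} \<union> {i \<in> {1..s + b}. B \<inter> A i \<noteq> {}})"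
      by (rule arg_cong[where f = card]) auto
    also have "\<dots> = card {i \<in> {1..s + b}. B \<inter> A i = {}} + card {i \<in> {1..s + b}. B \<inter> A i \<noteq> {}}"
      by (intro card_Un_disjoint) auto
    finally have split: "card {i \<in> {1..s + b}. B \<inter> A i = {}} + card {i \<in> {1..s + b}. B \<inter> A i \<noteq> {}} = s + b"
      by simp
    show ?thesis
    proof (cases "B \<inter> T = {}")
      case True
      have "card {i \<in> {1..s + b}. B \<inter> A i \<noteq> {}} < b + 1"
        by (rule card_meeting_outside_lt[OF _ A finT deg less True]) auto
      then show ?thesis using split s True by linarith
    next
      case False
      then obtain y where y: "y \<in> B" "y \<in> T" by blast
      have "card {i \<in> {1..s + b}. y \<in> A i} \<le> card {i \<in> {1..s + b}. B \<inter> A i \<noteq> {}}"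
        using y by (intro card_mono) auto
      then show ?thesis using split deg[OF y(2)] False by linarith
    qed
  qed
  then show ?thesis unfolding star_part_def by blast
qed

section \<open>Relabelling the ground set\<close>

lemma ex_permutes_initial:
  assumes "X \<subseteq> {1..n}" "card X = r - 1" "x \<in> {1..n} - X" "1 \<le> r"
  shows "\<exists>\<pi>. \<pi> permutes {1..n} \<and> \<pi> ` X = {1..r - 1} \<and> \<pi> x = r"
proof -
  have finX: "finite X" using assms(1) finite_subset by blast
  define R where "R = {1..n} - insert x X"
  have cx: "card (insert x X) = r" using finX assms by simp
  then have rn: "r \<le> n" using card_mono[of "{1..n}" "insert x X"] assms by auto
  have cR: "card R = n - r" unfolding R_def using finX assms cx by (subst card_Diff_subset) auto
  obtain f where f: "bij_betw f X {1..r - 1}"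
    using finite_same_card_bij[OF finX, of "{1..r - 1}"] assms(2) by auto
  have "finite R" by (simp add: R_def)
  then obtain g where g: "bij_betw g R {r + 1..n}"
    using finite_same_card_bij[of R "{r + 1..n}"] cR by auto
  define \<pi> where "\<pi> = (\<lambda>a. if a \<in> X then f a else if a = x then r else if a \<in> R then g a else a)"
  have 1: "bij_betw \<pi> X {1..r - 1}"
    using f by (rule bij_betw_cong[THEN iffD1, rotated]) (simp add: \<pi>_def)
  have 2: "bij_betw \<pi> {x} {r}" using assms(3) by (simp add: \<pi>_def)
  have 3: "bij_betw \<pi> R {r + 1..n}"
    using g by (rule bij_betw_cong[THEN iffD1, rotated]) (auto simp: \<pi>_def R_def)
  have "bij_betw \<pi> ((X \<union> {x}) \<union> R) (({1..r - 1} \<union> {r}) \<union> {r + 1..n})"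
    by (intro bij_betw_combine 1 2 3) (use assms(4) in auto)
  moreover have "(X \<union> {x}) \<union> R = {1..n}" using assms by (auto simp: R_def)
  moreover have "({1..r - 1} \<union> {r}) \<union> {r + 1..n} = {1..n}" using assms(4) rn by auto
  ultimately have "bij_betw \<pi> {1..n} {1..n}" by simp
  moreover have "\<pi> a = a" if "a \<notin> {1..n}" for a using that assms by (auto simp: \<pi>_def R_def)
  ultimately have "\<pi> permutes {1..n}" by (rule bij_imp_permutes)
  moreover have "\<pi> ` X = {1..r - 1}" using 1 by (rule bij_betw_imp_surj_on)
  moreover have "\<pi> x = r" using assms(3) by (simp add: \<pi>_def)
  ultimately show ?thesis by blast
qed

lemma permutes_image_nsets:
  assumes "\<pi> permutes S" "B \<in> nsets S k"
  shows "\<pi> ` B \<in> nsets S k"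
proof -
  have "card (\<pi> ` B) = card B"
    by (rule card_image) (rule inj_on_subset[OF permutes_inj[OF assms(1)] subset_UNIV])
  moreover have "\<pi> ` B \<subseteq> S"
    using assms permutes_image[OF assms(1)] by (auto simp: nsets_def)
  ultimately show ?thesis using assms(2) by (auto simp: nsets_def)
qed

lemma permutes_image_nsets_Collect:
  assumes "\<pi> permutes S" and PQ: "\<And>B. B \<in> nsets S k \<Longrightarrow> P B \<longleftrightarrow> Q (\<pi> ` B)"
  shows "(\<lambda>B. \<pi> ` B) ` {B \<in> nsets S k. P B} = {B \<in> nsets S k. Q B}"
proof (intro equalityI subsetI)
  fix B assume "B \<in> (\<lambda>B. \<pi> ` B) ` {B \<in> nsets S k. P B}"
  then show "B \<in> {B \<in> nsets S k. Q B}" using permutes_image_nsets[OF assms(1)] PQ by auto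
next
  fix B assume B: "B \<in> {B \<in> nsets S k. Q B}"
  then have "inv \<pi> ` B \<in> nsets S k" using permutes_image_nsets[OF permutes_inv[OF assms(1)]] by blast
  moreover have "\<pi> ` inv \<pi> ` B = B"
    using permutes_inverses(1)[OF assms(1)] by (simp add: image_image)
  ultimately show "B \<in> (\<lambda>B. \<pi> ` B) ` {B \<in> nsets S k. P B}"
    using B PQ[of "inv \<pi> ` B"] by (intro image_eqI[of _ _ "inv \<pi> ` B"]) auto
qed

lemma union_intersecting_mono:
  assumes "union_intersecting s t \<H>" "\<G> \<subseteq> \<H>"
  shows "union_intersecting s t \<G>"
  unfolding union_intersecting_def
proof (intro allI impI)
  fix B :: "nat \<Rightarrow> 'a set" assume "inj_on B {1..s + t} \<and> B ` {1..s + t} \<subseteq> \<G>"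
  then have "inj_on B {1..s + t} \<and> B ` {1..s + t} \<subseteq> \<H>" using assms(2) by (meson subset_trans)
  then show "(\<Union>i\<in>{1..s}. B i) \<inter> (\<Union>i\<in>{1..t}. B (s + i)) \<noteq> {}"
    using assms(1)[unfolded union_intersecting_def] by (elim allE[of _ B]) (rule mp)
qed

text \<open>A permutation carries \<open>X\<close> to \<open>[r - 1]\<close> and \<open>x\<close> to
  \<open>r\<close>. The \<open>A i\<close> are the images of the members avoiding \<open>X\<close>
  and \<open>x\<close>; the \<open>F i\<close> are those of the members through \<open>x\<close>
  that avoid \<open>X\<close> and \<open>Y\<close>.\<close>

lemma extremal_family_if_multi_star_extremal:
  assumes ext: "multi_star_extremal n k r s t b m \<F> X x Y" and F: "\<F> \<subseteq> nsets {1..n} k"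
    and m: "(s + b) * k div (b + 1) = m" and pos: "1 \<le> s" "1 \<le> t" "1 \<le> r" "1 \<le> m"
  defines "p \<equiv> s + b"
  shows "\<exists>A F. inj_on A {1..p} \<and> A ` {1..p} \<subseteq> nsets {1..n} k
            \<and> inj_on F {1..t - 1} \<and> F ` {1..t - 1} \<subseteq> nsets {1..n} k
            \<and> {1..r} \<inter> (\<Union>i\<in>{1..p}. A i) = {}
            \<and> card (T_set p A s) = m
            \<and> (\<forall>i\<in>{1..t - 1}. F i \<in> star n k r - star_part n k r p A s \<and> F i \<inter> {1..r - 1} = {})
            \<and> union_intersecting s t (A ` {1..p} \<union> F ` {1..t - 1})
            \<and> isomorphic_families n \<F>
                ((\<Union>i\<in>{1..r - 1}. star n k i) \<union> star_part n k r p A s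
                  \<union> A ` {1..p} \<union> F ` {1..t - 1})"
proof -
  define \<G> where "\<G> = {A \<in> \<F>. A \<inter> X = {}}"
  define \<A> where "\<A> = {A \<in> \<G>. x \<notin> A}"
  define \<B> where "\<B> = {A \<in> \<G>. x \<in> A \<and> A \<inter> Y = {}}"
  have X: "X \<subseteq> {1..n}" "card X = r - 1" "{B \<in> nsets {1..n} k. B \<inter> X \<noteq> {}} \<subseteq> \<F>"
    and free: "\<And>\<S> \<T>. \<S> \<subseteq> \<G> \<Longrightarrow> \<T> \<subseteq> \<G> \<Longrightarrow> card \<S> = s \<Longrightarrow> card \<T> = t \<Longrightarrow> \<not> cross_disjoint \<S> \<T>"
    using ext by (simp_all add: multi_star_extremal_def \<G>_def)
  have se: "star_extremal ({1..n} - X) k s t b m \<G> x Y"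
    using ext by (simp add: multi_star_extremal_def \<G>_def)
  then have x: "x \<in> {1..n} - X" and Y: "Y \<subseteq> {1..n} - X - {x}" "card Y = m"
    and cA: "card \<A> = p" and deg: "\<And>y. y \<in> Y \<Longrightarrow> b + 1 \<le> card {A \<in> \<A>. y \<in> A}"
    and hit: "{B \<in> nsets ({1..n} - X) k. x \<in> B \<and> B \<inter> Y \<noteq> {}} \<subseteq> \<G>"
    and cB: "card \<B> = t - 1"
    by (simp_all add: star_extremal_def \<A>_def \<B>_def p_def)
  have finF: "finite \<F>" using F finite_imp_finite_nsets finite_subset by blast
  then have fin: "finite \<A>" "finite \<B>" by (simp_all add: \<A>_def \<B>_def \<G>_def)
  have finY: "finite Y" using Y(1) finite_subset by blast
  obtain \<pi> where \<pi>: "\<pi> permutes {1..n}" "\<pi> ` X = {1..r - 1}" "\<pi> x = r"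
    using ex_permutes_initial[OF X(1,2) x pos(3)] by blast
  have inj: "inj \<pi>" using \<pi>(1) by (rule permutes_inj)
  have imem: "\<pi> a \<in> \<pi> ` B \<longleftrightarrow> a \<in> B" for a B using inj by (rule inj_image_mem_iff)
  have iint: "\<pi> ` B \<inter> \<pi> ` C = {} \<longleftrightarrow> B \<inter> C = {}" for B C
    by (simp flip: image_Int[OF inj])
  have iinj: "inj_on (\<lambda>B. \<pi> ` B) \<H>" for \<H>
    using inj by (simp add: inj_on_def inj_image_eq_iff)
  obtain A0 where A0: "bij_betw A0 {1..p} \<A>"
    using ex_bij_betw_nat_finite_1[OF fin(1)] cA by auto
  obtain F0 where F0: "bij_betw F0 {1..t - 1} \<B>"
    using ex_bij_betw_nat_finite_1[OF fin(2)] cB by auto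
  define A where "A = (\<lambda>i. \<pi> ` A0 i)"
  define F' where "F' = (\<lambda>i. \<pi> ` F0 i)"
  have A0i: "A0 i \<in> \<A>" if "i \<in> {1..p}" for i using A0 that by (rule bij_betwE[rule_format])
  have F0i: "F0 i \<in> \<B>" if "i \<in> {1..t - 1}" for i using F0 that by (rule bij_betwE[rule_format])
  have Aim: "A ` {1..p} = (\<lambda>B. \<pi> ` B) ` \<A>"
    using bij_betw_imp_surj_on[OF A0] by (simp add: A_def flip: image_image)
  have Fim: "F' ` {1..t - 1} = (\<lambda>B. \<pi> ` B) ` \<B>"
    using bij_betw_imp_surj_on[OF F0] by (simp add: F'_def flip: image_image)
  have sub: "\<A> \<subseteq> nsets {1..n} k" "\<B> \<subseteq> nsets {1..n} k" using F by (auto simp: \<A>_def \<B>_def \<G>_def)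
  have Ain: "A i \<in> nsets {1..n} k" if "i \<in> {1..p}" for i
    using A0i[OF that] sub(1) permutes_image_nsets[OF \<pi>(1)] by (auto simp: A_def)
  have Fin: "F' i \<in> nsets {1..n} k" if "i \<in> {1..t - 1}" for i
    using F0i[OF that] sub(2) permutes_image_nsets[OF \<pi>(1)] by (auto simp: F'_def)
  have Afin: "finite (A i) \<and> card (A i) = k" if "i \<in> {1..p}" for i
    using Ain[OF that] by (auto simp: nsets_def)
  have injA: "inj_on A {1..p}"
    unfolding A_def using comp_inj_on[OF bij_betw_imp_inj_on[OF A0] iinj] by (simp add: comp_def)
  have injF: "inj_on F' {1..t - 1}"
    unfolding F'_def using comp_inj_on[OF bij_betw_imp_inj_on[OF F0] iinj] by (simp add: comp_def)
  have "A i \<inter> {1..r} = {}" if "i \<in> {1..p}" for i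
  proof -
    have "{1..r} = \<pi> ` insert x X" using \<pi>(2,3) pos(3) by auto
    moreover have "A0 i \<inter> insert x X = {}" using A0i[OF that] by (auto simp: \<A>_def \<G>_def)
    ultimately show ?thesis unfolding A_def by (simp only: iint)
  qed
  then have disjr: "{1..r} \<inter> (\<Union>i\<in>{1..p}. A i) = {}" by blast
  have degA: "b + 1 \<le> card {i \<in> {1..p}. z \<in> A i}" if z: "z \<in> \<pi> ` Y" for z
  proof -
    obtain y where y: "y \<in> Y" "z = \<pi> y" using z by blast
    have "A0 ` {i \<in> {1..p}. z \<in> A i} = {A \<in> \<A>. y \<in> A}"
      using bij_betw_imp_surj_on[OF A0] by (auto simp: A_def y(2) imem)
    moreover have "inj_on A0 {i \<in> {1..p}. z \<in> A i}"
      using bij_betw_imp_inj_on[OF A0] by (rule inj_on_subset) auto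
    ultimately show ?thesis using deg[OF y(1)] by (metis card_image)
  qed
  have cY: "card (\<pi> ` Y) = m" using Y(2) inj by (metis card_image inj_on_subset subset_UNIV)
  have less: "card {1..p} * k < (card (\<pi> ` Y) + 1) * (b + 1)"
    unfolding cY m[symmetric] p_def using dividend_less_div_times[of "b + 1" "(s + b) * k"]
    by (simp add: algebra_simps)
  \<comment> \<open>The image of \<open>Y\<close> has the largest size that the incidences allow, so
    no other element can have degree \<open>b + 1\<close>.\<close>
  have Tmem: "z \<in> \<pi> ` Y \<longleftrightarrow> b + 1 \<le> card {i \<in> {1..p}. z \<in> A i}" for z
  proof
    assume "b + 1 \<le> card {i \<in> {1..p}. z \<in> A i}"
    moreover have "card {i \<in> {1..p}. {z} \<inter> A i \<noteq> {}} < b + 1" if "z \<notin> \<pi> ` Y"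
      using that finY by (intro card_meeting_outside_lt[OF _ Afin _ degA less]) auto
    moreover have "{i \<in> {1..p}. {z} \<inter> A i \<noteq> {}} = {i \<in> {1..p}. z \<in> A i}" by auto
    ultimately show "z \<in> \<pi> ` Y" by (metis not_less)
  qed (rule degA)
  then have T: "T_set p A s = \<pi> ` Y"
    by (auto simp: T_set_def p_def)
  have sp: "star_part n k r p A s = {B \<in> star n k r. B \<inter> {1..r - 1} = {} \<and> B \<inter> \<pi> ` Y \<noteq> {}}"
    unfolding p_def
    by (rule star_part_eq) (use Afin pos(1) Tmem m cY finY in \<open>simp_all add: p_def\<close>)
  have Fprop: "F' i \<in> star n k r - star_part n k r p A s \<and> F' i \<inter> {1..r - 1} = {}"
    if "i \<in> {1..t - 1}" for i
  proof -
    have "x \<in> F0 i" "F0 i \<inter> Y = {}" "F0 i \<inter> X = {}" using F0i[OF that] by (auto simp: \<B>_def \<G>_def)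
    then have "r \<in> F' i" "F' i \<inter> \<pi> ` Y = {}" "F' i \<inter> {1..r - 1} = {}"
      unfolding F'_def \<pi>(2)[symmetric] by (auto simp: iint imem simp flip: \<pi>(3))
    then show ?thesis unfolding sp using Fin[OF that] by (simp add: star_def)
  qed
  \<comment> \<open>The property holds for the whole image of \<open>\<G>\<close>: pulled back along
    \<open>\<pi>\<close>, a violation becomes a cross-disjoint pair in \<open>\<G>\<close>.\<close>
  have "union_intersecting s t ((\<lambda>B. \<pi> ` B) ` \<G>)"
    unfolding union_intersecting_def
  proof (intro allI impI notI, elim conjE)
    fix B :: "nat \<Rightarrow> nat set"
    assume B: "inj_on B {1..s + t}" "B ` {1..s + t} \<subseteq> (\<lambda>B. \<pi> ` B) ` \<G>"
      and disj: "(\<Union>i\<in>{1..s}. B i) \<inter> (\<Union>i\<in>{1..t}. B (s + i)) = {}"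
    define C where "C = (\<lambda>i. inv \<pi> ` B i)"
    have BC: "B i = \<pi> ` C i" for i
      using permutes_inverses(1)[OF \<pi>(1)] by (simp add: C_def image_image)
    have CG: "C i \<in> \<G>" if "i \<in> {1..s + t}" for i
    proof -
      have "B i \<in> (\<lambda>B. \<pi> ` B) ` \<G>" by (rule subsetD[OF B(2) imageI[OF that]])
      then obtain D where "B i = \<pi> ` D" "D \<in> \<G>" by (rule imageE)
      moreover from this have "C i = D" using BC[of i] inj_image_eq_iff[OF inj, of "C i" D] by metis
      ultimately show ?thesis by simp
    qed
    have injC: "inj_on C {1..s + t}" 
    proof (rule inj_onI)
      fix i j assume ij: "i \<in> {1..s + t}" "j \<in> {1..s + t}" "C i = C j"
      then have "B i = B j" using BC[of i] BC[of j] by metis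
      then show "i = j" by (rule inj_onD[OF B(1) _ ij(1,2)])
    qed
    have "card (C ` {1..s}) = s"
      by (subst card_image) (auto intro: inj_on_subset[OF injC])
    moreover have "card (C ` {s + 1..s + t}) = t"
      by (subst card_image) (auto intro: inj_on_subset[OF injC])
    moreover have "C ` {1..s} \<subseteq> \<G>" "C ` {s + 1..s + t} \<subseteq> \<G>" using CG by auto
    moreover have "C i \<inter> C j = {}" if "i \<in> {1..s}" "j \<in> {s + 1..s + t}" for i j
    proof -
      have "j = s + (j - s)" "j - s \<in> {1..t}" using that(2) by auto
      then have "B j \<subseteq> (\<Union>i\<in>{1..t}. B (s + i))" by (metis UN_upper)
      moreover have "B i \<subseteq> (\<Union>i\<in>{1..s}. B i)" using that(1) by (rule UN_upper)
      ultimately have "B i \<inter> B j = {}" using disj by blast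
      then show ?thesis by (simp add: BC iint)
    qed
    then have "cross_disjoint (C ` {1..s}) (C ` {s + 1..s + t})" by (auto simp: cross_disjoint_def)
    ultimately show False using free by blast
  qed
  moreover have "A ` {1..p} \<union> F' ` {1..t - 1} \<subseteq> (\<lambda>B. \<pi> ` B) ` \<G>"
    unfolding Aim Fim by (auto simp: \<A>_def \<B>_def)
  ultimately have ui: "union_intersecting s t (A ` {1..p} \<union> F' ` {1..t - 1})"
    by (rule union_intersecting_mono)
  \<comment> \<open>The pieces correspond to those of the target family, so each can be mapped
    separately.\<close>
  have dec: "\<F> = {B \<in> nsets {1..n} k. B \<inter> X \<noteq> {}}
      \<union> {B \<in> nsets {1..n} k. x \<in> B \<and> B \<inter> X = {} \<and> B \<inter> Y \<noteq> {}} \<union> \<A> \<union> \<B>"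
  proof (intro equalityI subsetI)
    fix B assume "B \<in> \<F>"
    then show "B \<in> {B \<in> nsets {1..n} k. B \<inter> X \<noteq> {}}
      \<union> {B \<in> nsets {1..n} k. x \<in> B \<and> B \<inter> X = {} \<and> B \<inter> Y \<noteq> {}} \<union> \<A> \<union> \<B>"
      using F by (auto simp: \<A>_def \<B>_def \<G>_def)
  next
    have "{B \<in> nsets {1..n} k. x \<in> B \<and> B \<inter> X = {} \<and> B \<inter> Y \<noteq> {}}
        \<subseteq> {B \<in> nsets ({1..n} - X) k. x \<in> B \<and> B \<inter> Y \<noteq> {}}" by (auto simp: nsets_def)
    then have "{B \<in> nsets {1..n} k. x \<in> B \<and> B \<inter> X = {} \<and> B \<inter> Y \<noteq> {}} \<subseteq> \<F>"
      using hit by (auto simp: \<G>_def)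
    moreover fix B assume "B \<in> {B \<in> nsets {1..n} k. B \<inter> X \<noteq> {}}
      \<union> {B \<in> nsets {1..n} k. x \<in> B \<and> B \<inter> X = {} \<and> B \<inter> Y \<noteq> {}} \<union> \<A> \<union> \<B>"
    ultimately show "B \<in> \<F>" using X(3) by (auto simp: \<A>_def \<B>_def \<G>_def)
  qed
  have "(\<lambda>B. \<pi> ` B) ` {B \<in> nsets {1..n} k. B \<inter> X \<noteq> {}} = {B \<in> nsets {1..n} k. B \<inter> {1..r - 1} \<noteq> {}}"
    unfolding \<pi>(2)[symmetric] by (rule permutes_image_nsets_Collect[OF \<pi>(1)]) (simp add: iint)
  also have "\<dots> = (\<Union>i\<in>{1..r - 1}. star n k i)" by (auto simp: star_def)
  finally have i1: "(\<lambda>B. \<pi> ` B) ` {B \<in> nsets {1..n} k. B \<inter> X \<noteq> {}} = (\<Union>i\<in>{1..r - 1}. star n k i)" .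
  have "(\<lambda>B. \<pi> ` B) ` {B \<in> nsets {1..n} k. x \<in> B \<and> B \<inter> X = {} \<and> B \<inter> Y \<noteq> {}}
      = {B \<in> nsets {1..n} k. r \<in> B \<and> B \<inter> {1..r - 1} = {} \<and> B \<inter> \<pi> ` Y \<noteq> {}}"
    unfolding \<pi>(2)[symmetric]
    by (rule permutes_image_nsets_Collect[OF \<pi>(1)]) (simp add: iint imem flip: \<pi>(3))
  also have "\<dots> = star_part n k r p A s" unfolding sp by (auto simp: star_def)
  finally have i2: "(\<lambda>B. \<pi> ` B) ` {B \<in> nsets {1..n} k. x \<in> B \<and> B \<inter> X = {} \<and> B \<inter> Y \<noteq> {}}
      = star_part n k r p A s" .
  have "(\<lambda>B. \<pi> ` B) ` \<F> = (\<Union>i\<in>{1..r - 1}. star n k i) \<union> star_part n k r p A s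
      \<union> A ` {1..p} \<union> F' ` {1..t - 1}"
    by (subst dec) (simp only: image_Un i1 i2 Aim Fim)
  then have "isomorphic_families n \<F>
      ((\<Union>i\<in>{1..r - 1}. star n k i) \<union> star_part n k r p A s \<union> A ` {1..p} \<union> F' ` {1..t - 1})"
    unfolding isomorphic_families_def using \<pi>(1) by (intro exI[of _ \<pi>] conjI) simp_all
  moreover have "A ` {1..p} \<subseteq> nsets {1..n} k" "F' ` {1..t - 1} \<subseteq> nsets {1..n} k"
    using Ain Fin by blast+
  ultimately show ?thesis
    using injA injF disjr T cY Fprop ui by (intro exI[of _ A] exI[of _ F']) simp
qed

text \<open>The pieces are told apart by their trace on \<open>[r]\<close>: it meets
  \<open>[r - 1]\<close>, equals \<open>{r}\<close>, or is empty. The \<open>F i\<close> share the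
  trace \<open>{r}\<close> with \<open>star_part\<close> but are excluded from it.\<close>

lemma card_extremal_family:
  assumes A: "inj_on A {1..s + b}" "A ` {1..s + b} \<subseteq> nsets {1..n} k"
    and F: "inj_on F {1..t - 1}"
      "\<And>i. i \<in> {1..t - 1} \<Longrightarrow> F i \<in> star n k r - star_part n k r (s + b) A s \<and> F i \<inter> {1..r - 1} = {}"
    and disj: "{1..r} \<inter> (\<Union>i\<in>{1..s + b}. A i) = {}"
    and m: "card (T_set (s + b) A s) = m" "(s + b) * k div (b + 1) = m"
    and pos: "1 \<le> s" "1 \<le> t" "1 \<le> r" "1 \<le> m" "1 \<le> k" "r \<le> n"
  shows "card ((\<Union>i\<in>{1..r - 1}. star n k i) \<union> star_part n k r (s + b) A s
            \<union> A ` {1..s + b} \<union> F ` {1..t - 1})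
          + ((n - (r - 1)) choose k) + ((n - r - m) choose (k - 1))
        = (n choose k) + ((n - r) choose (k - 1)) + (s + b + t - 1)"
proof -
  define T where "T = T_set (s + b) A s"
  define V where "V = {1..n} - {1..r - 1}"
  let ?S = "\<Union>i\<in>{1..r - 1}. star n k i" and ?P = "star_part n k r (s + b) A s"
  have finN: "finite (nsets {1..n} k)" by (simp add: finite_imp_finite_nsets)
  have finT: "finite T" using m pos(4) by (simp add: T_def card_ge_0_finite)
  have Tmem: "y \<in> T \<longleftrightarrow> b + 1 \<le> card {i \<in> {1..s + b}. y \<in> A i}" for y
    by (simp add: T_def T_set_def)
  have Ai: "A i \<subseteq> {1..n}" "finite (A i) \<and> card (A i) = k" if "i \<in> {1..s + b}" for i
    using subsetD[OF A(2) imageI[OF that]] by (auto simp: nsets_def)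
  \<comment> \<open>An element of \<open>T\<close> has degree at least \<open>b + 1 > 0\<close>, so
    it lies in some \<open>A i\<close> and hence outside \<open>[r]\<close>.\<close>
  have Tsub: "T \<subseteq> V - {r}"
  proof
    fix y assume "y \<in> T"
    then have "card {i \<in> {1..s + b}. y \<in> A i} \<noteq> 0" unfolding Tmem by linarith
    then have "{i \<in> {1..s + b}. y \<in> A i} \<noteq> {}" by (metis card.empty)
    then obtain i where i: "i \<in> {1..s + b}" "y \<in> A i" by blast
    have "y \<notin> {1..r}" using disj i by blast
    moreover have "y \<in> {1..n}" using Ai(1)[OF i(1)] i(2) by (rule subsetD)
    ultimately show "y \<in> V - {r}" using pos(3) by (simp add: V_def)
  qed
  have P: "?P = {B \<in> star n k r. B \<inter> {1..r - 1} = {} \<and> B \<inter> T \<noteq> {}}"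
    by (rule star_part_eq) (use Ai(2) pos(1) Tmem m finT in \<open>simp_all add: T_def\<close>)
  have "?P = {B \<in> nsets V k. r \<in> B \<and> B \<inter> T \<noteq> {}}"
    unfolding P by (auto simp: star_def V_def nsets_def)
  moreover have rsub: "{1..r - 1} \<subseteq> {1..n}" using pos(6) by auto
  then have "card V = n - (r - 1)" unfolding V_def by (subst card_Diff_subset) simp_all
  moreover have "r \<in> V" using pos(3,6) by (auto simp: V_def)
  ultimately have cP: "card ?P + ((n - r - m) choose (k - 1)) = ((n - r) choose (k - 1))"
    using card_nsets_through_hitting[of V r T k] Tsub pos(3,5) m(1) by (simp add: V_def T_def)
  have "?S = {B \<in> nsets {1..n} k. B \<inter> {1..r - 1} \<noteq> {}}" by (auto simp: star_def)
  then have cS: "card ?S + ((n - (r - 1)) choose k) = (n choose k)"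
    using card_nsets_hitting[OF _ rsub, of k] by simp
  have fin: "finite ?S" "finite ?P"
    using finN by (auto simp: star_def star_part_def)
  have rA: "B \<inter> {1..r} = {}" if "B \<in> A ` {1..s + b}" for B using that disj by blast
  have d1: "?S \<inter> ?P = {}" by (auto simp: star_def star_part_def)
  have d2: "(?S \<union> ?P) \<inter> A ` {1..s + b} = {}"
  proof -
    have "B \<inter> {1..r} \<noteq> {}" if "B \<in> ?S \<union> ?P" for B
    proof -
      have "\<exists>i. i \<in> {1..r} \<and> i \<in> B" using that
      proof
        assume "B \<in> ?S"
        then obtain i where "i \<in> {1..r - 1}" "i \<in> B" by (auto simp: star_def)
        then show ?thesis by (intro exI[of _ i]) auto
      next
        assume "B \<in> ?P"
        then show ?thesis using pos(3) by (intro exI[of _ r]) (auto simp: star_part_def star_def)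
      qed
      then show ?thesis by blast
    qed
    then show ?thesis using rA by blast
  qed
  have d3: "(?S \<union> ?P \<union> A ` {1..s + b}) \<inter> F ` {1..t - 1} = {}"
  proof -
    have "F i \<notin> ?S \<and> F i \<notin> ?P \<and> F i \<notin> A ` {1..s + b}" if "i \<in> {1..t - 1}" for i
    proof (intro conjI)
      have Fi: "r \<in> F i" "F i \<notin> ?P" "F i \<inter> {1..r - 1} = {}" using F(2)[OF that] by (auto simp: star_def)
      show "F i \<notin> ?S" using Fi(3) by (auto simp: star_def)
      show "F i \<notin> ?P" by fact
      show "F i \<notin> A ` {1..s + b}" 
      proof
        assume "F i \<in> A ` {1..s + b}"
        then have "F i \<inter> {1..r} = {}" by (rule rA)
        moreover have "r \<in> {1..r}" using pos(3) by simp
        ultimately show False using Fi(1) by blast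
      qed
    qed
    then show ?thesis by blast
  qed
  have "card (?S \<union> ?P \<union> A ` {1..s + b} \<union> F ` {1..t - 1}) = card ?S + card ?P + (s + b) + (t - 1)"
    using fin d1 d2 d3 card_image[OF A(1)] card_image[OF F(1)]
    by (simp add: card_Un_disjoint)
  then show ?thesis using cP cS pos(2) by linarith
qed

section \<open>The bound and both directions of the equality case\<close>

theorem theorem3:
  fixes k r \<beta> m b :: nat and s :: "nat \<Rightarrow> nat"
  assumes "k \<ge> 3" and "r \<ge> 1"
    and "\<And>i. 1 \<le> i \<Longrightarrow> i \<le> r \<Longrightarrow> s (i + 1) \<le> s i" and "s (r + 1) \<ge> 1"
    and m_eq: "m = (s (r + 1) + \<beta>) * k div (\<beta> + 1)"
    and b_eq: "b = beta_hat k (s (r + 1)) \<beta>"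
  shows "\<exists>n0. \<forall>n\<ge>n0. \<forall>\<F>. \<F> \<subseteq> nsets {1..n} k
    \<and> \<not> contains_subgraph (with_proj (kneser_graph n k) \<restriction> \<F>)
          (with_proj (complete_multipartite (r + 1) s))
    \<and> ell (r + 1) \<F> \<ge> s (r + 1) + \<beta> \<longrightarrow>
    (let N = int (n choose k) - int ((n - r) choose k) - int ((n - m - r) choose (k - 1))
           + int (s r) + int (s (r + 1)) + int b - 1;
         p = s (r + 1) + b
     in int (card \<F>) \<le> N \<and>
        (int (card \<F>) = N \<longleftrightarrow>
          (\<exists>A F. inj_on A {1..p} \<and> A ` {1..p} \<subseteq> nsets {1..n} k
            \<and> inj_on F {1..s r - 1} \<and> F ` {1..s r - 1} \<subseteq> nsets {1..n} k
            \<and> {1..r} \<inter> (\<Union>i\<in>{1..p}. A i) = {}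
            \<and> card (T_set p A (s (r + 1))) = m
            \<and> (\<forall>i\<in>{1..s r - 1}. F i \<in> star n k r - star_part n k r p A (s (r + 1))
                  \<and> F i \<inter> {1..r - 1} = {})
            \<and> union_intersecting (s (r + 1)) (s r) (A ` {1..p} \<union> F ` {1..s r - 1})
            \<and> isomorphic_families n \<F>
                ((\<Union>i\<in>{1..r - 1}. star n k i) \<union> star_part n k r p A (s (r + 1))
                  \<union> A ` {1..p} \<union> F ` {1..s r - 1}))))"
proof -
  define u t where "u = s (r + 1)" and "t = s r"
  have u: "1 \<le> u" using assms(4) by (simp add: u_def)
  have "u \<le> t" unfolding u_def t_def using assms(2) by (intro assms(3)) simp_all
  then have t: "1 \<le> t" using u by linarith
  have k1: "1 \<le> k" using assms(1) by simp
  have m_b: "(u + b) * k div (b + 1) = m"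
    using beta_hat_props(2)[OF u, where k = k and \<beta> = \<beta>] by (simp only: u_def m_eq b_eq)
  have m1: "1 \<le> m" using m_b quotient_eq[OF u, of b k] k1 by linarith
  obtain n0 where n0: "\<forall>n\<ge>n0. \<forall>\<F>. \<F> \<subseteq> nsets {1..n} k \<and>
      \<not> contains_subgraph (with_proj (kneser_graph n k) \<restriction> \<F>) (with_proj (complete_multipartite (r + 1) s)) \<and>
      u + \<beta> \<le> ell (r + 1) \<F> \<longrightarrow>
      card \<F> + ((n - (r - 1)) choose k) + ((n - r - m) choose (k - 1))
        < (n choose k) + ((n - r) choose (k - 1)) + (u + b + t - 1) \<or>
      card \<F> + ((n - (r - 1)) choose k) + ((n - r - m) choose (k - 1))
        = (n choose k) + ((n - r) choose (k - 1)) + (u + b + t - 1) \<and>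
      (\<exists>X x Y. multi_star_extremal n k r u t b m \<F> X x Y)"
    using extremal_structure[OF assms(1,2) u[unfolded u_def] t[unfolded t_def], of \<beta>,
      folded m_eq b_eq, folded u_def t_def] ..
  show ?thesis
    unfolding Let_def u_def[symmetric] t_def[symmetric]
  proof (intro exI[of _ "n0 + r"] allI impI)
    fix n \<F>
    assume n: "n0 + r \<le> n"
      and hyp: "\<F> \<subseteq> nsets {1..n} k
        \<and> \<not> contains_subgraph (with_proj (kneser_graph n k) \<restriction> \<F>) (with_proj (complete_multipartite (r + 1) s))
        \<and> u + \<beta> \<le> ell (r + 1) \<F>"
    define N where "N = int (n choose k) - int ((n - r) choose k) - int ((n - m - r) choose (k - 1))
        + int t + int u + int b - 1"
    \<comment> \<open>Pascal's rule reconciles the additive natural-number form, which splits off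
      \<open>r - 1\<close> stars first, with the integer bound in terms of
      \<open>n - r\<close>.\<close>
    have "n - (r - 1) = Suc (n - r)" using n assms(2) by simp
    then have pascal: "((n - (r - 1)) choose k) = ((n - r) choose (k - 1)) + ((n - r) choose k)"
      using k1 by (cases k) simp_all
    have comm: "n - m - r = n - r - m" by simp
    have N: "int c = N \<longleftrightarrow> c + ((n - (r - 1)) choose k) + ((n - r - m) choose (k - 1))
        = (n choose k) + ((n - r) choose (k - 1)) + (u + b + t - 1)"
      "int c < N \<longleftrightarrow> c + ((n - (r - 1)) choose k) + ((n - r - m) choose (k - 1))
        < (n choose k) + ((n - r) choose (k - 1)) + (u + b + t - 1)" for c
      unfolding N_def pascal comm using t by linarith+
    let ?E = "\<exists>A F. inj_on A {1..u + b} \<and> A ` {1..u + b} \<subseteq> nsets {1..n} k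
            \<and> inj_on F {1..t - 1} \<and> F ` {1..t - 1} \<subseteq> nsets {1..n} k
            \<and> {1..r} \<inter> (\<Union>i\<in>{1..u + b}. A i) = {}
            \<and> card (T_set (u + b) A u) = m
            \<and> (\<forall>i\<in>{1..t - 1}. F i \<in> star n k r - star_part n k r (u + b) A u
                  \<and> F i \<inter> {1..r - 1} = {})
            \<and> union_intersecting u t (A ` {1..u + b} \<union> F ` {1..t - 1})
            \<and> isomorphic_families n \<F>
                ((\<Union>i\<in>{1..r - 1}. star n k i) \<union> star_part n k r (u + b) A u
                  \<union> A ` {1..u + b} \<union> F ` {1..t - 1})"
    have dich: "int (card \<F>) < N \<or> int (card \<F>) = N \<and> (\<exists>X x Y. multi_star_extremal n k r u t b m \<F> X x Y)"
      unfolding N using n0[rule_format, OF _ hyp] n by simp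
    have "int (card \<F>) = N \<longleftrightarrow> ?E"
    proof
      assume "int (card \<F>) = N"
      then obtain X x Y where "multi_star_extremal n k r u t b m \<F> X x Y" using dich by auto
      then show ?E
        using hyp m_b u t assms(2) m1 by (intro extremal_family_if_multi_star_extremal) simp_all
    next
      assume ?E
      then obtain A F where AF: "inj_on A {1..u + b}" "A ` {1..u + b} \<subseteq> nsets {1..n} k"
        "inj_on F {1..t - 1}" "{1..r} \<inter> (\<Union>i\<in>{1..u + b}. A i) = {}"
        "card (T_set (u + b) A u) = m"
        "\<forall>i\<in>{1..t - 1}. F i \<in> star n k r - star_part n k r (u + b) A u \<and> F i \<inter> {1..r - 1} = {}"
        and iso: "isomorphic_families n \<F>
                ((\<Union>i\<in>{1..r - 1}. star n k i) \<union> star_part n k r (u + b) A u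
                  \<union> A ` {1..u + b} \<union> F ` {1..t - 1})"
        by (elim exE conjE) (rule that; assumption)
      obtain \<pi> where \<pi>: "\<pi> permutes {1..n}" "(\<Union>i\<in>{1..r - 1}. star n k i) \<union> star_part n k r (u + b) A u
          \<union> A ` {1..u + b} \<union> F ` {1..t - 1} = (\<lambda>B. \<pi> ` B) ` \<F>"
        using iso unfolding isomorphic_families_def by (elim exE conjE) (rule that; assumption)
      \<comment> \<open>Isomorphic families have equal size, so \<open>card_extremal_family\<close>
        computes \<open>card \<F>\<close>.\<close>
      have "inj_on (\<lambda>B. \<pi> ` B) \<F>"
        using permutes_inj[OF \<pi>(1)] by (simp add: inj_on_def inj_image_eq_iff)
      then have "card ((\<Union>i\<in>{1..r - 1}. star n k i) \<union> star_part n k r (u + b) A u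
          \<union> A ` {1..u + b} \<union> F ` {1..t - 1}) = card \<F>"
        unfolding \<pi>(2) by (rule card_image)
      moreover have "r \<le> n" using n by simp
      ultimately show "int (card \<F>) = N"
        unfolding N
        using card_extremal_family[OF AF(1-3) bspec[OF AF(6)] AF(4,5) m_b u t assms(2) m1 k1] by simp
    qed
    moreover have "int (card \<F>) \<le> N" using dich by auto
    ultimately show "int (card \<F>) \<le> int (n choose k) - int ((n - r) choose k) - int ((n - m - r) choose (k - 1))
        + int t + int u + int b - 1 \<and>
      (int (card \<F>) = int (n choose k) - int ((n - r) choose k) - int ((n - m - r) choose (k - 1))
        + int t + int u + int b - 1 \<longleftrightarrow> ?E)"
      unfolding N_def by blast
  qed
qed

end
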